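(* Let $c>0$, $\lambda\ge0$, $v\ge0$, let $R=\exp\bigl(\sqrt{\lambda v}\,Z-\tfrac{\lambda v}{2}\bigr)$ with $Z\sim N(0,1)$, and let $\mu_{c,\lambda,v}$ be the probability measure on $[0,\infty)$ whose Stieltjes transform $s$ satisfies \[ \frac1{s(z)}+z=\mathbb{E}\left[\frac{R}{1+cR\,s(z)}\right]\qquad\text{for all }z\in\mathbb{C}_+ . \] Then $\mu_{c,\lambda,v}$ is the free compound-Poisson law with rate $1/c$ and jump distribution equal to the law of $cR$. For every $k\ge1$ it has the finite moment \[ M_k=\int t^k\,\mu_{c,\lambda,v}(dt)=\sum_{\pi\in \mathrm{NC}(k)}c^{\,k-|\pi|}\prod_{V\in\pi}\mathbb{E}R^{|V|}. \] Equivalently, its free cumulants are \[ \kappa_k=c^{k-1}\,\mathbb{E}R^k=c^{k-1}\exp\!\left(\frac{k(k-1)}{2}\lambda v\right),\qquad k\ge1. \]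
   Context: $\mathbb{C}_+=\{z:\operatorname{Im}z>0\}$ and the Stieltjes transform of a probability measure $\mu$ on $\mathbb{R}$ is $s_\mu(z)=\int\frac1{t-z}\mu(dt)$. The measure $\mu_{c,\lambda,v}$ exists and is uniquely determined by the displayed equation; it is the almost-sure weak limit of the empirical spectral distributions of $S_n=\frac1N\sum_{\alpha=1}^N x^{(\alpha)}x^{(\alpha)\mathsf T}$, where $x^{(\alpha)}$ are independent copies of $x=(\prod_{i\in I}X_i)_{I\subseteq[n],|I|=d}$, with $X_i$ i.i.d. of mean $0$, variance $1$, finite fourth moment $1+v$, in the regime $d^2/n\to\lambda$, $\binom nd/N\to c$. $\mathrm{NC}(k)$ is the set of non-crossing partitions of $\{1,\dots,k\}$, $|\pi|$ the number of blocks of $\pi$, and $V\in\pi$ ranges over the blocks, of size $|V|$. The free cumulants $(\kappa_k)$ of a measure with finite moments $(M_k)$ are defined by $M_k=\sum_{\pi\in\mathrm{NC}(k)}\prod_{V\in\pi}\kappa_{|V|}$. The free compound-Poisson law with rate $\theta>0$ and jump distribution $\rho$ (a probability measure on $[0,\infty)$, possibly with unbounded support) is the probability measure $\pi$ whose Voiculescu transform is $\phi_\pi(\zeta)=\theta\int\frac{t\zeta}{\zeta-t}\,\rho(dt)$; here $\phi_\pi(\zeta)=F_\pi^{-1}(\zeta)-\zeta$, where $F_\pi=1/G_\pi$, $G_\pi=-s_\pi$, and $F_\pi^{-1}$ is the analytic right inverse of $F_\pi$ on a truncated cone $\{\operatorname{Im}\zeta>\beta,\ |\operatorname{Re}\zeta|<\alpha\operatorname{Im}\zeta\}$.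 *)

theory Defs
  imports "HOL-Probability.Probability" "HOL-Complex_Analysis.Complex_Analysis"
begin

definition stieltjes :: "real measure \<Rightarrow> complex \<Rightarrow> complex" where
  "stieltjes \<mu> z = (LINT t|\<mu>. 1 / (complex_of_real t - z))"

definition cauchy_transform :: "real measure \<Rightarrow> complex \<Rightarrow> complex" where
  "cauchy_transform \<mu> z = - stieltjes \<mu> z"

definition reciprocal_cauchy :: "real measure \<Rightarrow> complex \<Rightarrow> complex" where
  "reciprocal_cauchy \<mu> z = 1 / cauchy_transform \<mu> z"

definition truncated_cone :: "real \<Rightarrow> real \<Rightarrow> complex set" where
  "truncated_cone \<alpha> \<beta> = {\<zeta>. Im \<zeta> > \<beta> \<and> \<bar>Re \<zeta>\<bar> < \<alpha> * Im \<zeta>}"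

(* The condition h \<zeta> ~ \<zeta> at infinity singles out the branch that is meant.  Without it the
   right inverse need not be unique: for \<mu> = (\<delta>\<^sub>1 + \<delta>\<^sub>-\<^sub>1)/2 one has F(z) = z - 1/z, and for large
   \<zeta> in a cone both solutions of F(z) = \<zeta>, z ~ \<zeta> and z ~ -1/\<zeta>, lie in the upper half-plane. *)
definition F_right_inverse_on ::
  "real measure \<Rightarrow> complex set \<Rightarrow> (complex \<Rightarrow> complex) \<Rightarrow> bool" where
  "F_right_inverse_on \<mu> D h \<longleftrightarrow>
     h holomorphic_on D \<and>
     (\<forall>\<zeta>\<in>D. Im (h \<zeta>) > 0 \<and> reciprocal_cauchy \<mu> (h \<zeta>) = \<zeta>) \<and>
     ((\<lambda>\<zeta>. h \<zeta> / \<zeta>) \<longlongrightarrow> 1) (inf at_infinity (principal D))"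

(* As usual for measures that need not have bounded support: for every aperture \<alpha> the inverse
   is required to exist on a sufficiently high truncation of the cone. *)
definition has_Voiculescu_transform ::
  "real measure \<Rightarrow> (complex \<Rightarrow> complex) \<Rightarrow> bool" where
  "has_Voiculescu_transform \<mu> \<phi> \<longleftrightarrow>
     (\<forall>\<alpha>>0. \<exists>\<beta>>0. \<exists>h. F_right_inverse_on \<mu> (truncated_cone \<alpha> \<beta>) h \<and>
        (\<forall>\<zeta>\<in>truncated_cone \<alpha> \<beta>. \<phi> \<zeta> = h \<zeta> - \<zeta>))"

definition is_free_compound_Poisson ::
  "real \<Rightarrow> real measure \<Rightarrow> real measure \<Rightarrow> bool" where
  "is_free_compound_Poisson \<theta> \<rho> \<pi> \<longleftrightarrow>
     \<theta> > 0 \<and> real_distribution \<rho> \<and> (AE t in \<rho>. 0 \<le> t) \<and> real_distribution \<pi> \<and>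
     has_Voiculescu_transform \<pi>
       (\<lambda>\<zeta>. complex_of_real \<theta> *
          (LINT t|\<rho>. complex_of_real t * \<zeta> / (\<zeta> - complex_of_real t)))"

definition noncrossing :: "nat set set \<Rightarrow> bool" where
  "noncrossing P \<longleftrightarrow>
     \<not> (\<exists>V\<in>P. \<exists>W\<in>P. V \<noteq> W \<and>
          (\<exists>a b c d. a < b \<and> b < c \<and> c < d \<and> a \<in> V \<and> c \<in> V \<and> b \<in> W \<and> d \<in> W))"

definition NC :: "nat \<Rightarrow> nat set set set" where
  "NC k = {P. partition_on {1..k} P \<and> noncrossing P}"

definition moment :: "real measure \<Rightarrow> nat \<Rightarrow> real" where
  "moment \<mu> k = (LINT t|\<mu>. t ^ k)"

(* Meaningful only for \<mu> with finite moments.  The moment-cumulant relations for k \<ge> 1 do not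
   involve \<kappa> 0, which is set to 0 to make the sequence unique. *)
definition free_cumulant :: "real measure \<Rightarrow> nat \<Rightarrow> real" where
  "free_cumulant \<mu> =
     (THE \<kappa>. \<kappa> 0 = 0 \<and> (\<forall>k\<ge>1. moment \<mu> k = (\<Sum>P\<in>NC k. \<Prod>V\<in>P. \<kappa> (card V))))"

end

theory Submission
  imports Defs
begin

text \<open>
Write \<open>G = - s\<close> and \<open>F = 1 / G\<close>. In terms of \<open>F\<close> the equation for \<open>s\<close> says
\<open>z = F z + \<phi> (F z)\<close>, where \<open>\<phi> \<zeta> = E [R \<zeta> / (\<zeta> - c R)]\<close> is exactly the Voiculescu transform of the
free compound-Poisson law with rate \<open>1 / c\<close> and jumps \<open>c R\<close>. So \<open>h \<zeta> = \<zeta> + \<phi> \<zeta>\<close> is a left inverse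
of \<open>F\<close> on the upper half-plane. On a cone \<open>\<phi>\<close> is bounded, because \<open>cmod (\<zeta> - c R)\<close> is at least
\<open>Im \<zeta>\<close>, hence comparable to \<open>cmod \<zeta>\<close>; therefore \<open>h\<close> maps a high truncated cone into the upper
half-plane and \<open>h \<zeta> / \<zeta>\<close> tends to \<open>1\<close>. Since \<open>F\<close> is injective, its image is open, and it meets
every such cone because \<open>F (\<i> y)\<close> is asymptotic to \<open>\<i> y\<close>. There \<open>F (h \<zeta>) = \<zeta>\<close>, and the identity
theorem spreads this to the whole cone (\<open>right_inverse_of_left_inverse\<close>,
\<open>free_compound_Poisson_of_equation\<close>).

The lognormal moments grow so fast that, for \<open>lam * v > 0\<close>, the series of the cumulants diverges
everywhere except at \<open>0\<close>, so the moments of \<open>\<mu>\<close> are read off from an asymptotic expansion. The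
equation extends by continuity to the negative axis (\<open>boundary_equation\<close>): with \<open>w = 1 / z < 0\<close>, the
function \<open>g w = G (1 / w)\<close> satisfies \<open>g = w * (1 + E [R g / (1 - c R g)])\<close>. The bracket has an
asymptotic expansion in \<open>g\<close> to every order, with coefficients \<open>\<kappa> k = c ^ (k - 1) * E [R ^ k]\<close>. Each
passage through this fixed-point equation gains one order, so \<open>g\<close> has the expansion of the formal
solution to every order (\<open>expands_fixed_point\<close>). Expanding the kernel of \<open>g\<close> by the finite geometric
series and letting \<open>w\<close> increase to \<open>0\<close>, monotone convergence then shows that all moments of \<open>\<mu>\<close> are
finite and are the coefficients of that formal solution (\<open>moments_of_expansion\<close>).

It remains to solve \<open>A = K (X A)\<close>, with \<open>K\<close> the generating series of \<open>\<kappa>\<close> and \<open>\<kappa> 0 = 1\<close>, by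
noncrossing partitions (\<open>nc_fps_compose\<close>). The usual decomposition of a noncrossing partition removes
the whole block of the first point and leaves as many gaps as this block has elements. Here only the
first point is removed: if \<open>q\<close> is the next point of its block, the points before \<open>q\<close> and the points
from \<open>q\<close> on carry two independent noncrossing partitions. The price is that the removed point has to be
remembered, as a shift \<open>j\<close> of the size of the block of the first point; the generating series for
shift \<open>j\<close> is the shifted series of \<open>\<kappa>\<close> composed with \<open>X A\<close>.
\<close>

section \<open>Cutting a noncrossing partition at the second point of its first block\<close>

text \<open>
Arbitrary intervals occur because the recursion below cuts \<open>{a..<b}\<close> into \<open>{a}\<close>, \<open>{a+1..<q}\<close> and
\<open>{q..<b}\<close>, without renumbering the pieces.
\<close>

definition ncp :: "nat \<Rightarrow> nat \<Rightarrow> nat set set set" where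
  "ncp a b = {P. partition_on {a..<b} P \<and> noncrossing P}"

text \<open>
As a union this is the empty set when no block contains \<open>x\<close>. That value makes the case in which the
block of the first point is a singleton an instance of the general one.
\<close>

definition block_of :: "nat \<Rightarrow> nat set set \<Rightarrow> nat set" where
  "block_of x P = \<Union>{V\<in>P. x \<in> V}"

text \<open>
Adds the point \<open>a\<close> to the block of \<open>q\<close> in \<open>Q\<close>. For \<open>q\<close> beyond the last point, \<open>Q\<close> is empty and \<open>a\<close>
becomes a singleton block.
\<close>

definition glue :: "nat \<Rightarrow> nat \<Rightarrow> nat set set \<Rightarrow> nat set set \<Rightarrow> nat set set" where
  "glue a q P Q = insert (insert a (block_of q Q)) (P \<union> (Q - {block_of q Q}))"

definition cut_at :: "nat \<Rightarrow> nat \<Rightarrow> nat set set \<Rightarrow> nat" where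
  "cut_at a b P = Min (insert b (block_of a P - {a}))"

definition lower_part :: "nat \<Rightarrow> nat \<Rightarrow> nat set set \<Rightarrow> nat set set" where
  "lower_part a q P = {W\<in>P. W \<subseteq> {Suc a..<q}}"

text \<open>
When the block of \<open>a\<close> is a singleton, what remains of it is the empty set, which must not be a block.
\<close>

definition upper_part :: "nat \<Rightarrow> nat \<Rightarrow> nat \<Rightarrow> nat set set \<Rightarrow> nat set set" where
  "upper_part a q b P = insert (block_of a P - {a}) {W\<in>P. W \<subseteq> {q..<b}} - {{}}"

text \<open>
The block of \<open>a\<close> is weighted as if it had \<open>j\<close> further elements, namely those already cut off.
\<close>

definition weight :: "(nat \<Rightarrow> 'r::comm_semiring_1) \<Rightarrow> nat \<Rightarrow> nat \<Rightarrow> nat set set \<Rightarrow> 'r" where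
  "weight \<kappa> j a P = \<kappa> (j + card (block_of a P)) * (\<Prod>V\<in>P - {block_of a P}. \<kappa> (card V))"

lemma finite_ncp [simp]: "finite (ncp a b)"
  unfolding ncp_def using finitely_many_partition_on[of "{a..<b}"]
  by (rule rev_finite_subset) auto

lemma ncp_empty: "ncp a a = {{}}"
  by (auto simp: ncp_def noncrossing_def partition_on_empty)

lemma partition_on_blockD:
  assumes "partition_on A P"
  shows "\<And>V. V \<in> P \<Longrightarrow> V \<subseteq> A" "\<And>V. V \<in> P \<Longrightarrow> V \<noteq> {}"
    "\<And>V W x. V \<in> P \<Longrightarrow> W \<in> P \<Longrightarrow> x \<in> V \<Longrightarrow> x \<in> W \<Longrightarrow> V = W"
    "\<And>x. x \<in> A \<Longrightarrow> \<exists>V\<in>P. x \<in> V"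
  using assms by (auto simp: partition_on_def disjoint_def)

lemma block_of_empty [simp]: "block_of x {} = {}"
  by (simp add: block_of_def)

lemma block_of_eqI:
  assumes "partition_on A P" "V \<in> P" "x \<in> V"
  shows "block_of x P = V"
  using partition_on_blockD(3)[OF assms(1)] assms(2,3) by (auto simp: block_of_def)

lemma block_of_mem:
  assumes "partition_on A P" "x \<in> A"
  shows "block_of x P \<in> P" "x \<in> block_of x P"
  using partition_on_blockD(4)[OF assms] block_of_eqI[OF assms(1)] by force+

lemma noncrossingD:
  assumes "noncrossing P" "V \<in> P" "W \<in> P" "x < y" "y < z" "z < w"
    "x \<in> V" "z \<in> V" "y \<in> W" "w \<in> W"
  shows "V = W"
  using assms unfolding noncrossing_def by blast

lemma block_of_glue:
  assumes "P \<in> ncp (Suc a) q" "Q \<in> ncp q b" "a < q"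
  shows "block_of a (glue a q P Q) = insert a (block_of q Q)"
proof -
  have "a \<notin> V" if "V \<in> P \<or> V \<in> Q" for V
  proof -
    have "V \<subseteq> {Suc a..<q} \<or> V \<subseteq> {q..<b}" using that assms partition_on_blockD(1) by (auto simp: ncp_def)
    then show ?thesis using assms(3) by auto
  qed
  then have "{V \<in> glue a q P Q. a \<in> V} = {insert a (block_of q Q)}"
    by (auto simp: glue_def)
  then show ?thesis by (simp add: block_of_def)
qed

text \<open>
The two cases in which \<open>glue\<close> is used: nothing lies above the cut, or the cut point has a block.
\<close>

lemma block_of_left_end:
  assumes "Q \<in> ncp q b" "q \<le> b"
  shows "(q = b \<and> Q = {} \<and> block_of q Q = {}) \<or>
    (q < b \<and> q \<in> block_of q Q \<and> block_of q Q \<in> Q \<and> block_of q Q \<subseteq> {q..<b})"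
proof (cases "q = b")
  case True
  then show ?thesis using assms by (simp add: ncp_empty block_of_def)
next
  case False
  then have "partition_on {q..<b} Q" "q \<in> {q..<b}" using assms by (auto simp: ncp_def)
  then show ?thesis using block_of_mem partition_on_blockD(1) False assms(2) by (metis order_le_neq_trans)
qed

text \<open>
No new crossing arises. All points of \<open>P\<close> precede all points of \<open>Q\<close>, so blocks of \<open>P\<close> cross nothing
outside \<open>P\<close>. If the enlarged block crosses a block of \<open>Q\<close>, either \<open>a\<close> is not among the four crossing
points, or it can be replaced by \<open>q\<close>, the first point of \<open>Q\<close>; both give a crossing within \<open>Q\<close>.
\<close>

lemma glue_in_ncp:
  assumes P: "P \<in> ncp (Suc a) q" and Q: "Q \<in> ncp q b" and q: "a < q" "q \<le> b"
  shows "glue a q P Q \<in> ncp a b"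
proof -
  let ?B = "block_of q Q"
  have pP: "partition_on {Suc a..<q} P" and pQ: "partition_on {q..<b} Q"
    and nP: "noncrossing P" and nQ: "noncrossing Q"
    using P Q by (auto simp: ncp_def)
  note eP = partition_on_blockD[OF pP] and eQ = partition_on_blockD[OF pQ]
  have uP: "\<Union>P = {Suc a..<q}" and uQ: "\<Union>Q = {q..<b}"
    using pP pQ by (auto simp: partition_on_def)
  note B = block_of_left_end[OF Q q(2)]
  have BQ: "?B \<union> \<Union>(Q - {?B}) = {q..<b}" using B uQ by auto
  have Bx: "x \<notin> W" if "x \<in> ?B" "W \<in> Q - {?B}" for x W
    using that B eQ(3) by auto
  have "\<Union>(glue a q P Q) = {a} \<union> {Suc a..<q} \<union> (?B \<union> \<Union>(Q - {?B}))"
    unfolding glue_def using uP by auto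
  also have "\<dots> = {a..<b}" unfolding BQ using q by auto
  finally have U: "\<Union>(glue a q P Q) = {a..<b}" .
  have loP: "Suc a \<le> x \<and> x < q" if "V \<in> P" "x \<in> V" for V x using that eP(1) by fastforce
  have loQ: "q \<le> x \<and> x < b" if "V \<in> Q" "x \<in> V" for V x using that eQ(1) by fastforce
  have loB: "q \<le> x \<and> x < b" if "x \<in> ?B" for x using that B by auto
  have D: "disjoint (glue a q P Q)"
  proof (rule disjointI)
    fix V W assume VW: "V \<in> glue a q P Q" "W \<in> glue a q P Q" "V \<noteq> W"
    show "V \<inter> W = {}"
    proof (rule ccontr)
      assume "V \<inter> W \<noteq> {}"
      then obtain x where x: "x \<in> V" "x \<in> W" by auto
      have c: "V \<in> P \<or> V \<in> Q - {?B} \<or> V = insert a ?B" "W \<in> P \<or> W \<in> Q - {?B} \<or> W = insert a ?B"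
        using VW by (auto simp: glue_def)
      show False
      proof (cases "x = a")
        case True
        then have "V \<notin> P" "V \<notin> Q" "W \<notin> P" "W \<notin> Q"
          using loP[of V a] loP[of W a] loQ[of V a] loQ[of W a] x q by auto
        then show False using c VW(3) by auto
      next
        case xa: False
        show False
        proof (cases "x < q")
          case True
          then have "V \<notin> Q" "x \<notin> ?B" "W \<notin> Q" using x(1,2) True loB loQ by (meson leD)+
          then have "V \<in> P" "W \<in> P" using c x xa by auto
          then show False using eP(3) x VW(3) by auto
        next
          case False
          then have "V \<notin> P" "W \<notin> P" using x loP by auto
          then show False using c x xa VW(3) Bx eQ(3) by (metis Diff_iff insert_iff)
        qed
      qed
    qed
  qed
  have N: "noncrossing (glue a q P Q)"
    unfolding noncrossing_def
  proof (rule notI, elim bexE conjE exE)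
    fix V W x y z w
    assume VW: "V \<in> glue a q P Q" "W \<in> glue a q P Q" "V \<noteq> W"
      and o: "x < y" "y < z" "z < w" and m: "x \<in> V" "z \<in> V" "y \<in> W" "w \<in> W"
    have BB: "?B \<in> Q" if "u \<in> ?B" for u using that B by auto
    consider "V \<in> P" | "V \<in> Q - {?B}" | "V = insert a ?B" using VW by (auto simp: glue_def)
    then show False
    proof cases
      case 1
      then have "z < q" "Suc a \<le> x" using loP m by auto
      then have "y \<noteq> a" "\<not> q \<le> y" using o by auto
      then have "W \<in> P" using VW(2) m(3) loQ loB by (auto simp: glue_def)
      then show False using noncrossingD[OF nP 1 _ o m] VW(3) by simp
    next
      case 2
      then have "q \<le> x" using loQ m by auto
      then have yw: "y > q" "w > q" "y \<noteq> a" "w \<noteq> a" using o q by auto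
      then have "W \<notin> P" using loP[OF _ m(3)] by auto
      then consider "W \<in> Q" | "W = insert a ?B" using VW by (auto simp: glue_def)
      then show False
      proof cases
        case 1
        then show False using noncrossingD[OF nQ _ 1 o m] 2 VW(3) by simp
      next
        case b: 2
        then have "y \<in> ?B" "w \<in> ?B" using m yw by auto
        then show False using noncrossingD[OF nQ _ BB o m(1,2)] 2 by auto
      qed
    next
      \<comment> \<open>The crossing block is the enlarged one, and only its first crossing point can be \<open>a\<close>; \<open>q\<close> takes its place.\<close>
      case 3
      have W: "W \<in> P \<or> W \<in> Q - {?B}" using VW 3 by (auto simp: glue_def)
      then have "y > a" using loP[OF _ m(3)] loQ[OF _ m(3)] q by auto
      then have z: "z \<in> ?B" using m 3 o by auto
      have "w > q" using loB[OF z] o by auto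
      then have W: "W \<in> Q - {?B}" using W loP[OF _ m(4)] by auto
      then have "y > q \<or> y = q" using loQ[OF _ m(3)] by auto
      moreover have "y \<noteq> q" using W Bx m B by auto
      ultimately have "y > q" by auto
      moreover have "q \<in> ?B" using B z by auto
      ultimately show False
        using noncrossingD[OF nQ BB[OF z] _ _ o(2,3) _ z m(3,4)] W by auto
    qed
  qed
  have "{} \<notin> glue a q P Q" using eP(2) eQ(2) by (auto simp: glue_def)
  then show ?thesis using U D N by (simp add: ncp_def partition_on_def)
qed

lemma cut_glue:
  assumes P: "P \<in> ncp (Suc a) q" and Q: "Q \<in> ncp q b" and q: "a < q" "q \<le> b"
  shows "cut_at a b (glue a q P Q) = q" "lower_part a q (glue a q P Q) = P"
    "upper_part a q b (glue a q P Q) = Q"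
proof -
  let ?B = "block_of q Q"
  have pP: "partition_on {Suc a..<q} P" and pQ: "partition_on {q..<b} Q"
    using P Q by (auto simp: ncp_def)
  note eP = partition_on_blockD[OF pP] and eQ = partition_on_blockD[OF pQ]
  note B = block_of_left_end[OF Q q(2)]
  have aB: "a \<notin> ?B" using B q by auto
  have bl: "block_of a (glue a q P Q) - {a} = ?B"
    using block_of_glue[OF P Q q(1)] aB by auto
  have fB: "finite ?B" using B finite_subset[of ?B "{q..<b}"] by auto
  show "cut_at a b (glue a q P Q) = q"
    unfolding cut_at_def bl by (rule Min_eqI) (use B fB q in auto)
  have nL: "\<not> W \<subseteq> {Suc a..<q}" if "W \<in> Q" for W
    using eQ(1,2)[OF that] by fastforce
  have nU: "\<not> W \<subseteq> {q..<b}" if "W \<in> P" for W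
    using eP(1,2)[OF that] by fastforce
  have "\<not> insert a ?B \<subseteq> {Suc a..<q}" by simp
  then show "lower_part a q (glue a q P Q) = P"
    unfolding lower_part_def glue_def using eP(1) nL by blast
  have "\<not> insert a ?B \<subseteq> {q..<b}" using q by simp
  then have "{W \<in> glue a q P Q. W \<subseteq> {q..<b}} = Q - {?B}"
    unfolding glue_def using eQ(1) nU by blast
  then show "upper_part a q b (glue a q P Q) = Q"
    unfolding upper_part_def bl using B eQ(2) by auto
qed

text \<open>
Noncrossing enters only here: a block with points on both sides of \<open>q\<close> would cross the block that
contains \<open>a\<close> and \<open>q\<close>. Hence every other block lies entirely below or entirely above the cut, and the
partition is recovered from its two parts.
\<close>

lemma glue_cut:
  assumes P: "P \<in> ncp a b" and ab: "a < b"
  defines "q \<equiv> cut_at a b P"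
  shows "a < q" "q \<le> b" "lower_part a q P \<in> ncp (Suc a) q" "upper_part a q b P \<in> ncp q b"
    "glue a q (lower_part a q P) (upper_part a q b P) = P"
proof -
  let ?V = "block_of a P" and ?L = "lower_part a q P" and ?U = "upper_part a q b P"
  have pP: "partition_on {a..<b} P" and nP: "noncrossing P"
    using P by (auto simp: ncp_def)
  note eP = partition_on_blockD[OF pP]
  have V: "?V \<in> P" "a \<in> ?V" using block_of_mem[OF pP] ab by auto
  have Vs: "?V \<subseteq> {a..<b}" using eP(1) V by auto
  have fV: "finite ?V" using finite_subset[OF Vs] by simp
  have "q \<in> insert b (?V - {a})" unfolding q_def cut_at_def by (rule Min_in) (use fV in auto)
  then have qV: "q = b \<or> q \<in> ?V \<and> q \<noteq> a" by auto
  show aq: "a < q" using qV Vs ab by fastforce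
  show qb: "q \<le> b" using qV Vs by fastforce
  have qmin: "q \<le> x" if "x \<in> ?V" "x \<noteq> a" for x
    unfolding q_def cut_at_def using that fV by (intro Min_le) auto
  have split: "W \<subseteq> {Suc a..<q} \<or> W \<subseteq> {q..<b}" if W: "W \<in> P" "W \<noteq> ?V" for W
  proof (rule ccontr)
    assume neg: "\<not> ?thesis"
    have Ws: "W \<subseteq> {a..<b}" "a \<notin> W" using eP(1)[OF W(1)] eP(3)[OF W(1) V(1) _ V(2)] W(2) by auto
    obtain x where x: "x \<in> W" "\<not> q \<le> x" using neg Ws by fastforce
    have "W \<subseteq> {Suc a..<b}" using Ws by (auto simp: Suc_le_eq le_less)
    then obtain y where y: "y \<in> W" "q \<le> y" using neg by fastforce
    have xy: "x \<in> W" "y \<in> W" "x < q" "q \<le> y" using x y by auto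
    then have "q < b" using Ws by fastforce
    then have qV: "q \<in> ?V" using qV by auto
    then have "y \<noteq> q" using eP(3)[OF W(1) V(1) _ qV] W(2) xy by auto
    then have "a < x" "x < q" "q < y" using xy Ws by (auto simp: less_le)
    then show False using noncrossingD[OF nP V(1) W(1) _ _ _ V(2) qV xy(1,2)] W(2) by simp
  qed
  have VU: "?V - {a} \<subseteq> {q..<b}"
  proof
    fix x assume "x \<in> ?V - {a}"
    then show "x \<in> {q..<b}" using qmin[of x] subsetD[OF Vs, of x] by simp
  qed
  have VL: "\<not> ?V \<subseteq> {Suc a..<q}" "\<not> ?V \<subseteq> {q..<b}" using V aq by auto
  have memU: "W \<in> ?U \<longleftrightarrow> W \<noteq> {} \<and> (W = ?V - {a} \<or> (W \<in> P \<and> W \<subseteq> {q..<b}))" for W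
    by (auto simp: upper_part_def)
  have memL: "W \<in> ?L \<longleftrightarrow> W \<in> P \<and> W \<subseteq> {Suc a..<q}" for W
    by (auto simp: lower_part_def)
  have pL: "partition_on {Suc a..<q} ?L"
  proof (rule partition_onI)
    show "\<Union>?L = {Suc a..<q}"
    proof (intro equalityI subsetI)
      fix x assume x: "x \<in> {Suc a..<q}"
      then obtain W where W: "W \<in> P" "x \<in> W" using eP(4)[of x] qb by auto
      then have "W \<noteq> ?V" using qmin x by fastforce
      then show "x \<in> \<Union>?L" using split[OF W(1)] W x memL by fastforce
    qed (auto simp: lower_part_def)
  next
    show "{} \<notin> ?L" using eP(2) by (auto simp: lower_part_def)
  next
    show "disjnt V W" if "V \<in> ?L" "W \<in> ?L" "V \<noteq> W" for V W
      using that eP(3) by (auto simp: lower_part_def disjnt_def)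
  qed
  have pU: "partition_on {q..<b} ?U"
  proof (rule partition_onI)
    show "\<Union>?U = {q..<b}"
    proof (intro equalityI subsetI)
      fix x assume x: "x \<in> {q..<b}"
      then obtain W where W: "W \<in> P" "x \<in> W" using eP(4)[of x] aq by auto
      show "x \<in> \<Union>?U"
      proof (cases "W = ?V")
        case True
        then show ?thesis using W x aq memU by (intro UnionI[of "?V - {a}"]) auto
      next
        case False
        then show ?thesis using split[OF W(1)] W x memU by (intro UnionI[of W]) fastforce+
      qed
    next
      fix x assume "x \<in> \<Union>?U"
      then obtain W where W: "W \<in> ?U" "x \<in> W" by blast
      then have "W \<subseteq> {q..<b}" using VU memU[of W] by metis
      then show "x \<in> {q..<b}" using W(2) by (rule subsetD)
    qed
  next
    show "{} \<notin> ?U" by (simp add: upper_part_def)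
  next
    show "disjnt W W'" if WW: "W \<in> ?U" "W' \<in> ?U" "W \<noteq> W'" for W W'
    proof -
      have D: "?V \<inter> X = {}" if "X \<in> P" "X \<subseteq> {q..<b}" for X
        using that VL(2) eP(3) V(1) by blast
      have "disjnt X Y" if "X \<in> P" "Y \<in> P" "X \<noteq> Y" for X Y
        using that eP(3) by (auto simp: disjnt_def)
      then show ?thesis using WW D unfolding memU disjnt_def by fast
    qed
  qed
  have nL: "noncrossing ?L"
    unfolding noncrossing_def lower_part_def using noncrossingD[OF nP] by (metis (no_types, lifting) mem_Collect_eq)
  have nU: "noncrossing ?U"
    unfolding noncrossing_def
  proof (rule notI, elim bexE conjE exE)
    fix X Y x y z w
    assume XY: "X \<in> ?U" "Y \<in> ?U" "X \<noteq> Y"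
      and o: "x < y" "y < z" "z < w" and m: "x \<in> X" "z \<in> X" "y \<in> Y" "w \<in> Y"
    have ext: "\<exists>X'\<in>P. X \<subseteq> X' \<and> (X' = ?V \<longleftrightarrow> X = ?V - {a}) \<and> (X = ?V - {a} \<or> X' = X)" if "X \<in> ?U" for X
      using that V VL unfolding memU by (cases "X = ?V - {a}") auto
    obtain X' Y' where "X' \<in> P" "X \<subseteq> X'" "Y' \<in> P" "Y \<subseteq> Y'" "X' \<noteq> Y'"
      using ext[OF XY(1)] ext[OF XY(2)] XY(3) by metis
    then show False using noncrossingD[OF nP, of X' Y' x y z w] o m by blast
  qed
  show L: "?L \<in> ncp (Suc a) q" using pL nL by (simp add: ncp_def)
  show U: "?U \<in> ncp q b" using pU nU by (simp add: ncp_def)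
  have bl: "block_of q ?U = ?V - {a}"
  proof (cases "q = b")
    case True
    then have "?V - {a} = {}" using VU by auto
    moreover have "block_of q ?U = {}" using U True by (simp add: ncp_empty block_of_def)
    ultimately show ?thesis by simp
  next
    case False
    then have "q \<in> ?V - {a}" using qV by auto
    then show ?thesis by (intro block_of_eqI[OF pU]) (auto simp: memU)
  qed
  have "?V - {a} \<noteq> W" if "W \<in> P" "W \<noteq> {}" for W using eP(3)[OF that(1) V(1)] that V by blast
  then have "W \<in> glue a q ?L ?U \<longleftrightarrow> W \<in> P" for W
    unfolding glue_def bl using split[of W] memL[of W] memU[of W] V eP(2) by (auto simp: insert_absorb)
  then show "glue a q ?L ?U = P" by blast
qed

section \<open>Generating series of noncrossing partitions\<close>

lemma weight_glue:
  assumes P: "P \<in> ncp (Suc a) q" and Q: "Q \<in> ncp q b" and q: "a < q" "q \<le> b"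
  shows "weight \<kappa> j a (glue a q P Q) = (\<Prod>V\<in>P. \<kappa> (card V)) * weight \<kappa> (Suc j) q Q"
proof -
  let ?B = "block_of q Q"
  have pP: "partition_on {Suc a..<q} P" and pQ: "partition_on {q..<b} Q"
    using P Q by (auto simp: ncp_def)
  note eP = partition_on_blockD[OF pP] and eQ = partition_on_blockD[OF pQ]
  note B = block_of_left_end[OF Q q(2)]
  have fB: "finite ?B" using B finite_subset[of ?B "{q..<b}"] by auto
  have aB: "a \<notin> ?B" using B q by auto
  have fin: "finite P" "finite Q" using pP pQ finite_elements by blast+
  have "glue a q P Q - {insert a ?B} = P \<union> (Q - {?B})"
    unfolding glue_def using eP(1) eQ(1) q by fastforce
  moreover have "P \<inter> (Q - {?B}) = {}" using eP(1,2) eQ(1) by fastforce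
  ultimately show ?thesis
    using fin fB aB unfolding weight_def block_of_glue[OF P Q q(1)]
    by (simp add: prod.union_disjoint mult_ac)
qed

text \<open>
The convention \<open>\<kappa> 0 = 1\<close> is what makes this true for the empty interval, too: there the block of
\<open>a\<close> is empty.
\<close>

lemma weight_zero:
  assumes P: "P \<in> ncp a b" and "a \<le> b" "\<kappa> 0 = 1"
  shows "weight \<kappa> 0 a P = (\<Prod>V\<in>P. \<kappa> (card V))"
  using block_of_left_end[OF P assms(2)]
proof
  assume "a < b \<and> a \<in> block_of a P \<and> block_of a P \<in> P \<and> block_of a P \<subseteq> {a..<b}"
  moreover have "finite P" using P finite_elements by (auto simp: ncp_def)
  ultimately show ?thesis by (simp add: weight_def prod.remove[of P "block_of a P"])
qed (simp add: weight_def assms)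

text \<open>
The bijection \<open>glue\<close>, with inverse given by \<open>cut_at\<close>, \<open>lower_part\<close> and \<open>upper_part\<close>, is summed over all
positions \<open>q\<close> of the cut. Cutting off \<open>a\<close> raises the shift of the upper part by one.
\<close>

lemma weight_sum_rec:
  assumes ab: "a < b" and k0: "\<kappa> 0 = 1"
  shows "(\<Sum>P\<in>ncp a b. weight \<kappa> j a P) =
    (\<Sum>q\<in>{a<..b}. (\<Sum>P\<in>ncp (Suc a) q. weight \<kappa> 0 (Suc a) P) * (\<Sum>Q\<in>ncp q b. weight \<kappa> (Suc j) q Q))"
proof -
  have w: "weight \<kappa> 0 (Suc a) P * weight \<kappa> (Suc j) q Q = weight \<kappa> j a (glue a q P Q)"
    if "P \<in> ncp (Suc a) q" "Q \<in> ncp q b" "a < q" "q \<le> b" for P Q q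
    using weight_zero[of P "Suc a" q \<kappa>, OF that(1) _ k0] that(3) by (simp only: weight_glue[OF that] Suc_le_eq)
  have "(\<Sum>P\<in>ncp a b. weight \<kappa> j a P) =
    (\<Sum>(q, P, Q)\<in>(SIGMA q:{a<..b}. ncp (Suc a) q \<times> ncp q b). weight \<kappa> 0 (Suc a) P * weight \<kappa> (Suc j) q Q)"
    by (rule sum.reindex_bij_witness[where j = "\<lambda>P. (cut_at a b P, lower_part a (cut_at a b P) P, upper_part a (cut_at a b P) b P)"
          and i = "\<lambda>(q, P, Q). glue a q P Q"])
      (use glue_cut[OF _ ab] cut_glue glue_in_ncp w in auto)
  also have "\<dots> = (\<Sum>q\<in>{a<..b}. \<Sum>(P, Q)\<in>ncp (Suc a) q \<times> ncp q b. weight \<kappa> 0 (Suc a) P * weight \<kappa> (Suc j) q Q)"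
    by (subst sum.Sigma) auto
  finally show ?thesis by (simp add: sum.cartesian_product sum_product)
qed

text \<open>
Both sides satisfy the same recursion. Splitting the first coefficient off the shifted series,
\<open>K j = \<kappa> j + X * K (j + 1)\<close>, and composing with \<open>X * Mf\<close> gives
\<open>K j (X Mf) = \<kappa> j + X * Mf * K (j + 1) (X Mf)\<close>, whose coefficients are the convolution in
\<open>weight_sum_rec\<close>. The coefficients of \<open>Mf\<close> in that convolution have smaller index, so they are covered
by the induction hypothesis with shift \<open>0\<close>.
\<close>

lemma weight_sum_compose:
  fixes \<kappa> :: "nat \<Rightarrow> 'r::idom"
  assumes k0: "\<kappa> 0 = 1"
  defines "Mf \<equiv> Abs_fps (\<lambda>n. \<Sum>P\<in>ncp 0 n. \<Prod>V\<in>P. \<kappa> (card V))"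
  shows "(\<Sum>P\<in>ncp a (a + n). weight \<kappa> j a P) = fps_nth (Abs_fps (\<lambda>s. \<kappa> (j + s)) oo (fps_X * Mf)) n"
proof -
  define K where "K j = Abs_fps (\<lambda>s. \<kappa> (j + s))" for j
  define N where "N = Abs_fps (\<lambda>n. \<Sum>P\<in>ncp 0 n. weight \<kappa> 0 0 P)"
  have N: "N = Mf" unfolding N_def Mf_def using weight_zero[of _ 0 _ \<kappa>] k0 by simp
  have K: "K j = fps_const (\<kappa> j) + fps_X * K (Suc j)" for j
    by (rule fps_ext) (simp add: K_def fps_X_mult_nth)
  have X0: "fps_nth (fps_X * Mf) 0 = 0" by simp
  have Kc: "K j oo (fps_X * Mf) = fps_const (\<kappa> j) + fps_X * (Mf * (K (Suc j) oo (fps_X * Mf)))" for j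
    by (subst K) (simp add: fps_compose_add_distrib fps_compose_mult_distrib[OF X0] mult.assoc)
  have "(\<Sum>P\<in>ncp a (a + n). weight \<kappa> j a P) = fps_nth (K j oo (fps_X * Mf)) n"
  proof (induction n arbitrary: a j rule: less_induct)
    case (less n)
    show ?case
    proof (cases n)
      case 0
      then show ?thesis by (subst Kc) (simp add: ncp_empty weight_def)
    next
      case (Suc m)
      let ?W = "\<lambda>j n. fps_nth (K j oo (fps_X * Mf)) n"
      have M: "fps_nth Mf i = ?W 0 i" if "i < n" for i
        using less.IH[OF that, of 0 0] by (simp flip: N add: N_def)
      have "(\<Sum>P\<in>ncp a (a + n). weight \<kappa> j a P) =
        (\<Sum>q\<in>{a<..a+n}. (\<Sum>P\<in>ncp (Suc a) q. weight \<kappa> 0 (Suc a) P) * (\<Sum>Q\<in>ncp q (a+n). weight \<kappa> (Suc j) q Q))"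
        by (rule weight_sum_rec) (use Suc k0 in auto)
      also have "\<dots> = (\<Sum>i=0..m. fps_nth Mf i * ?W (Suc j) (m - i))"
      proof (rule sum.reindex_bij_witness[where i = "\<lambda>i. Suc a + i" and j = "\<lambda>q. q - Suc a"])
        fix q assume q: "q \<in> {a<..a + n}"
        then have lt: "q - Suc a < n" by auto
        have "(\<Sum>P\<in>ncp (Suc a) q. weight \<kappa> 0 (Suc a) P) = fps_nth Mf (q - Suc a)"
          using less.IH[OF lt, of 0 "Suc a"] M[OF lt] q by simp
        moreover have "(\<Sum>Q\<in>ncp q (a+n). weight \<kappa> (Suc j) q Q) = ?W (Suc j) (m - (q - Suc a))"
        proof -
          have "m - (q - Suc a) < n" "q + (m - (q - Suc a)) = a + n" using q Suc by auto
          then show ?thesis using less.IH[of "m - (q - Suc a)" "Suc j" q] by metis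
        qed
        ultimately show "fps_nth Mf (q - Suc a) * ?W (Suc j) (m - (q - Suc a)) =
          (\<Sum>P\<in>ncp (Suc a) q. weight \<kappa> 0 (Suc a) P) * (\<Sum>Q\<in>ncp q (a+n). weight \<kappa> (Suc j) q Q)"
          by simp
      qed (use Suc in auto)
      also have "\<dots> = ?W j n"
      proof -
        have "?W j (Suc m) = fps_nth (Mf * (K (Suc j) oo (fps_X * Mf))) m" by (subst Kc) simp
        then show ?thesis by (simp add: Suc fps_mult_nth)
      qed
      finally show ?thesis .
    qed
  qed
  then show ?thesis by (simp add: K_def)
qed

text \<open>
The functional equation that links free cumulants and moments, as an identity of formal power series.
\<close>

lemma nc_fps_compose:
  fixes \<kappa> :: "nat \<Rightarrow> 'r::idom"
  assumes k0: "\<kappa> 0 = 1"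
  defines "Mf \<equiv> Abs_fps (\<lambda>n. \<Sum>P\<in>ncp 0 n. \<Prod>V\<in>P. \<kappa> (card V))"
  shows "Abs_fps \<kappa> oo (fps_X * Mf) = Mf"
proof (rule fps_ext)
  fix n
  have "fps_nth Mf n = (\<Sum>P\<in>ncp 0 (0 + n). weight \<kappa> 0 0 P)"
    unfolding Mf_def using weight_zero[of _ 0 n \<kappa>] k0 by simp
  also have "\<dots> = fps_nth (Abs_fps \<kappa> oo (fps_X * Mf)) n"
    by (subst weight_sum_compose[of \<kappa>, OF k0]) (simp add: Mf_def)
  finally show "fps_nth (Abs_fps \<kappa> oo (fps_X * Mf)) n = fps_nth Mf n" by simp
qed

text \<open>
By \<open>weight_sum_compose\<close> the sum depends on the interval only through its length.
\<close>

lemma nc_sum_shift: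
  fixes \<kappa> :: "nat \<Rightarrow> 'r::idom"
  assumes k0: "\<kappa> 0 = 1"
  shows "(\<Sum>P\<in>ncp a (a + n). \<Prod>V\<in>P. \<kappa> (card V)) = (\<Sum>P\<in>ncp 0 n. \<Prod>V\<in>P. \<kappa> (card V))"
proof -
  have "(\<Sum>P\<in>ncp a (a + n). \<Prod>V\<in>P. \<kappa> (card V)) = (\<Sum>P\<in>ncp a (a + n). weight \<kappa> 0 a P)" for a
    using weight_zero[of _ a "a + n" \<kappa>] k0 by simp
  from this[of a] this[of 0] show ?thesis
    using weight_sum_compose[of \<kappa> 0 a n, OF k0] weight_sum_compose[of \<kappa> 0 0 n, OF k0] by simp
qed

section \<open>Moments and free cumulants\<close>

lemma NC_eq_ncp: "NC k = ncp 1 (1 + k)"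
  by (simp add: NC_def ncp_def atLeastLessThanSuc_atLeastAtMost)

lemma NC_partition:
  assumes "P \<in> NC k"
  shows "partition_on {1..k} P" "finite P" "(\<Sum>V\<in>P. card V) = k"
    "\<And>V. V \<in> P \<Longrightarrow> 1 \<le> card V"
proof -
  show p: "partition_on {1..k} P" using assms by (simp add: NC_def)
  show f: "finite P" using finite_elements[OF _ p] by simp
  have fV: "finite V" if "V \<in> P" for V
    using partition_on_blockD(1)[OF p that] finite_subset by blast
  have "card (\<Union>P) = (\<Sum>V\<in>P. card V)"
    using p fV by (intro card_Union_disjoint) (auto simp: partition_on_def)
  then show "(\<Sum>V\<in>P. card V) = k" using p by (simp add: partition_on_def)
  show "1 \<le> card V" if "V \<in> P" for V
    using fV[OF that] partition_on_blockD(2)[OF p that] by (simp add: Suc_le_eq card_gt_0_iff)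
qed

text \<open>
The exponents add up to \<open>k - card P\<close>, because the blocks have \<open>k\<close> elements in total.
\<close>

lemma NC_prod_power:
  assumes P: "P \<in> NC k"
  shows "(\<Prod>V\<in>P. c ^ (card V - 1) * f (card V)) = (c::real) ^ (k - card P) * (\<Prod>V\<in>P. f (card V))"
proof -
  have "(\<Sum>V\<in>P. card V - 1) = k - card P"
    using NC_partition(3,4)[OF P] by (simp add: sum_subtractf_nat)
  then show ?thesis by (simp add: prod.distrib flip: power_sum)
qed

lemma NC_block_card_less:
  assumes P: "P \<in> NC k" "P \<noteq> {{1..k}}" and V: "V \<in> P"
  shows "card V < k"
proof (rule ccontr)
  note p = NC_partition[OF P(1)]
  assume "\<not> card V < k"
  moreover have Vs: "V \<subseteq> {1..k}" using partition_on_blockD(1)[OF p(1) V] .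
  ultimately have Vk: "V = {1..k}" by (intro card_subset_eq) (auto dest: card_mono[rotated])
  have "W = V" if W: "W \<in> P" for W
    using partition_on_blockD(1,2)[OF p(1) W] partition_on_blockD(3)[OF p(1) W V] Vk by blast
  then have "P = {{1..k}}" using V Vk by blast
  then show False using P(2) by simp
qed

lemma one_block_in_NC: "k \<ge> 1 \<Longrightarrow> {{1..k}} \<in> NC k"
  by (auto simp: NC_def noncrossing_def partition_on_def)

text \<open>
The relation of order \<open>k\<close> contains \<open>\<kappa> k\<close> only in the term of the one-block partition, where it stands
alone; all other terms involve earlier cumulants.
\<close>

lemma cumulants_determined_by_moments:
  fixes \<kappa> \<kappa>' :: "nat \<Rightarrow> real"
  assumes "\<And>k. k \<ge> 1 \<Longrightarrow> (\<Sum>P\<in>NC k. \<Prod>V\<in>P. \<kappa> (card V)) = (\<Sum>P\<in>NC k. \<Prod>V\<in>P. \<kappa>' (card V))"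
    and "k \<ge> 1"
  shows "\<kappa> k = \<kappa>' k"
  using \<open>k \<ge> 1\<close>
proof (induction k rule: less_induct)
  case (less k)
  have fin: "finite (NC k)" by (simp add: NC_eq_ncp)
  have split: "(\<Sum>P\<in>NC k. \<Prod>V\<in>P. \<kappa> (card V)) = \<kappa> k + (\<Sum>P\<in>NC k - {{{1..k}}}. \<Prod>V\<in>P. \<kappa> (card V))" for \<kappa> :: "nat \<Rightarrow> real"
    by (subst sum.remove[OF fin one_block_in_NC[OF less.prems]]) simp
  have "(\<Sum>P\<in>NC k - {{{1..k}}}. \<Prod>V\<in>P. \<kappa> (card V)) = (\<Sum>P\<in>NC k - {{{1..k}}}. \<Prod>V\<in>P. \<kappa>' (card V))"
    by (intro sum.cong prod.cong refl less.IH) (use NC_block_card_less NC_partition(4) in auto)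
  then show ?case using assms(1)[OF less.prems] split by simp
qed

text \<open>
The definite description fixes the value at \<open>0\<close>, which no block ever uses, so \<open>\<kappa>\<close> is modified there.
\<close>

lemma free_cumulantI:
  assumes "\<And>k. k \<ge> 1 \<Longrightarrow> moment \<mu> k = (\<Sum>P\<in>NC k. \<Prod>V\<in>P. \<kappa> (card V))" and k: "k \<ge> 1"
  shows "free_cumulant \<mu> k = \<kappa> k"
proof -
  let ?\<kappa> = "\<lambda>k. if k = 0 then 0 else \<kappa> k"
  have eq: "(\<Sum>P\<in>NC k. \<Prod>V\<in>P. ?\<kappa> (card V)) = (\<Sum>P\<in>NC k. \<Prod>V\<in>P. \<kappa> (card V))" for k
    by (intro sum.cong prod.cong refl) (use NC_partition(4) in force)
  have "free_cumulant \<mu> = ?\<kappa>"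
    unfolding free_cumulant_def
  proof (rule the_equality)
    show "?\<kappa> 0 = 0 \<and> (\<forall>k\<ge>1. moment \<mu> k = (\<Sum>P\<in>NC k. \<Prod>V\<in>P. ?\<kappa> (card V)))"
      using assms(1) by (simp only: eq) simp
  next
    fix \<kappa>' assume \<kappa>': "\<kappa>' 0 = 0 \<and> (\<forall>k\<ge>1. moment \<mu> k = (\<Sum>P\<in>NC k. \<Prod>V\<in>P. \<kappa>' (card V)))"
    show "\<kappa>' = ?\<kappa>"
    proof
      fix k show "\<kappa>' k = ?\<kappa> k"
        using cumulants_determined_by_moments[of \<kappa>' \<kappa> k] \<kappa>' assms(1) by (cases "k = 0") auto
    qed
  qed
  then show ?thesis using k by simp
qed

section \<open>Asymptotic expansions at the origin from the left\<close>

text \<open>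
An asymptotic expansion with remainder \<open>o(w ^ n)\<close> as \<open>w\<close> increases to \<open>0\<close>. Storing the coefficients in
a formal power series lets sums, products and compositions of expansions be written as operations of
power series.
\<close>

definition expands :: "(real \<Rightarrow> real) \<Rightarrow> real fps \<Rightarrow> nat \<Rightarrow> bool" where
  "expands f A n \<longleftrightarrow>
     ((\<lambda>w. (f w - (\<Sum>i\<le>n. fps_nth A i * w ^ i)) / w ^ n) \<longlongrightarrow> 0) (at_left 0)"

lemma eventually_at_left_0_neg: "eventually (\<lambda>w::real. w < 0) (at_left 0)"
  unfolding eventually_at_filter by simp

lemma expands_const: "expands (\<lambda>w. a) (fps_const a) n"
proof -
  have "(\<Sum>i\<le>n. fps_nth (fps_const a) i * w ^ i) = a" for w
    by (subst sum.remove[of _ 0]) auto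
  then show ?thesis by (simp add: expands_def)
qed

lemma expands_cong:
  assumes "expands f A n" "\<And>i. i \<le> n \<Longrightarrow> fps_nth A i = fps_nth B i"
  shows "expands f B n"
  using assms by (simp add: expands_def)

lemma expands_add:
  assumes "expands f A n" "expands g B n"
  shows "expands (\<lambda>w. f w + g w) (A + B) n"
  using tendsto_add[OF assms[unfolded expands_def]]
  by (simp add: expands_def algebra_simps sum.distrib add_divide_distrib diff_divide_distrib)

lemma expands_tendsto:
  assumes "expands f A n"
  shows "(f \<longlongrightarrow> fps_nth A 0) (at_left 0)"
proof -
  let ?p = "\<lambda>w. \<Sum>i\<le>n. fps_nth A i * w ^ i"
  have "((\<lambda>w. (f w - ?p w) / w ^ n * w ^ n + ?p w) \<longlongrightarrow> 0 * 0 ^ n + (\<Sum>i\<le>n. fps_nth A i * 0 ^ i)) (at_left 0)"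
    using assms unfolding expands_def by (intro tendsto_intros)
  moreover have "(\<Sum>i\<le>n. fps_nth A i * 0 ^ i) = fps_nth A 0"
    by (subst sum.remove[of _ 0]) auto
  moreover have "eventually (\<lambda>w. (f w - ?p w) / w ^ n * w ^ n + ?p w = f w) (at_left 0)"
    using eventually_at_left_0_neg by eventually_elim simp
  ultimately have "(f \<longlongrightarrow> 0 * 0 ^ n + fps_nth A 0) (at_left 0)"
    by (simp only: Lim_transform_eventually)
  then show ?thesis by simp
qed

text \<open>
The product of the two Taylor polynomials differs from that of the product series by monomials of
degree above \<open>n\<close>, which are \<open>o(w ^ n)\<close>.
\<close>

lemma expands_mult:
  assumes f: "expands f A n" and g: "expands g B n"
  shows "expands (\<lambda>w. f w * g w) (A * B) n"
proof -
  let ?p = "\<lambda>A w. \<Sum>i\<le>n. fps_nth A i * w ^ i"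
  let ?D = "{(i, j). i \<le> n \<and> j \<le> n \<and> i + j > n}"
  let ?t = "\<lambda>w (i, j). fps_nth A i * fps_nth B j * w ^ (i + j)"
  have fin: "finite ?D" by (rule finite_subset[of _ "{..n} \<times> {..n}"]) auto
  have prod: "?p A w * ?p B w = ?p (A * B) w + (\<Sum>x\<in>?D. ?t w x)" for w
  proof -
    have "?p A w * ?p B w = (\<Sum>x\<in>{..n} \<times> {..n}. ?t w x)"
      by (simp add: sum_product sum.cartesian_product power_add mult_ac)
    also have "{..n} \<times> {..n} = {(i, j). i + j \<le> n} \<union> ?D" by auto
    also have "(\<Sum>x\<in>\<dots>. ?t w x) = (\<Sum>x\<in>{(i, j). i + j \<le> n}. ?t w x) + (\<Sum>x\<in>?D. ?t w x)"
      by (rule sum.union_disjoint)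
        (auto intro: finite_subset[of _ "{..n} \<times> {..n}"] fin)
    also have "(\<Sum>x\<in>{(i, j). i + j \<le> n}. ?t w x) = (\<Sum>k\<le>n. \<Sum>i\<le>k. ?t w (i, k - i))"
      using sum.triangle_reindex_eq[of "\<lambda>i j. ?t w (i, j)" n] by simp
    also have "\<dots> = ?p (A * B) w"
      by (simp add: fps_mult_nth sum_distrib_right atMost_atLeast0)
    finally show ?thesis .
  qed
  have "((\<lambda>w. \<Sum>x\<in>?D. case x of (i, j) \<Rightarrow> fps_nth A i * fps_nth B j * w ^ (i + j - n)) \<longlongrightarrow>
      (\<Sum>x\<in>?D. case x of (i, j) \<Rightarrow> fps_nth A i * fps_nth B j * 0 ^ (i + j - n))) (at_left 0)"
    by (auto intro!: tendsto_intros split: prod.split)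
  moreover have "(\<Sum>x\<in>?D. case x of (i, j) \<Rightarrow> fps_nth A i * fps_nth B j * 0 ^ (i + j - n)) = 0"
    by (rule sum.neutral) auto
  ultimately have "((\<lambda>w. (f w - ?p A w) / w ^ n * g w + ?p A w * ((g w - ?p B w) / w ^ n) +
      (\<Sum>x\<in>?D. case x of (i, j) \<Rightarrow> fps_nth A i * fps_nth B j * w ^ (i + j - n))) \<longlongrightarrow>
      0 * fps_nth B 0 + (\<Sum>i\<le>n. fps_nth A i * 0 ^ i) * 0 + 0) (at_left 0)"
    using f g expands_tendsto[OF g] unfolding expands_def by (intro tendsto_intros) auto
  moreover have "eventually (\<lambda>w. (f w - ?p A w) / w ^ n * g w + ?p A w * ((g w - ?p B w) / w ^ n) +
      (\<Sum>x\<in>?D. case x of (i, j) \<Rightarrow> fps_nth A i * fps_nth B j * w ^ (i + j - n)) =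
      (f w * g w - ?p (A * B) w) / w ^ n) (at_left 0)"
    using eventually_at_left_0_neg
  proof eventually_elim
    case (elim w)
    have "(\<Sum>x\<in>?D. case x of (i, j) \<Rightarrow> fps_nth A i * fps_nth B j * w ^ (i + j - n)) = (\<Sum>x\<in>?D. ?t w x) / w ^ n"
      unfolding sum_divide_distrib using elim
      by (intro sum.cong) (auto simp: power_diff)
    also have "\<dots> = (?p A w * ?p B w - ?p (A * B) w) / w ^ n" unfolding prod by simp
    finally show ?case by (simp add: diff_divide_distrib algebra_simps)
  qed
  ultimately have "((\<lambda>w. (f w * g w - ?p (A * B) w) / w ^ n) \<longlongrightarrow>
      0 * fps_nth B 0 + (\<Sum>i\<le>n. fps_nth A i * 0 ^ i) * 0 + 0) (at_left 0)"
    by (rule Lim_transform_eventually)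
  then show ?thesis by (simp add: expands_def)
qed

lemma expands_power: "expands f A n \<Longrightarrow> expands (\<lambda>w. f w ^ j) (A ^ j) n"
  by (induction j) (use expands_const[of 1] expands_mult in auto)

lemma expands_sum:
  "(\<And>j. j \<in> J \<Longrightarrow> expands (f j) (A j) n) \<Longrightarrow> expands (\<lambda>w. \<Sum>j\<in>J. f j w) (\<Sum>j\<in>J. A j) n"
  by (induction J rule: infinite_finite_induct) (use expands_const[of 0] expands_add in auto)

text \<open>
Since \<open>U\<close> has no constant term, \<open>U ^ j\<close> contributes nothing to the coefficients of order below \<open>j\<close>, so
truncating the outer series at \<open>n\<close> does not change coefficients up to \<open>n\<close>.
\<close>

lemma expands_polynomial_compose:
  assumes g: "expands g U n" and U0: "fps_nth U 0 = 0"
  shows "expands (\<lambda>w. \<Sum>j\<le>n. \<kappa> j * g w ^ j) (Abs_fps \<kappa> oo U) n"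
proof (rule expands_cong)
  show "expands (\<lambda>w. \<Sum>j\<le>n. \<kappa> j * g w ^ j) (\<Sum>j\<le>n. fps_const (\<kappa> j) * U ^ j) n"
    by (intro expands_sum expands_mult expands_const expands_power g)
next
  fix i assume i: "i \<le> n"
  have "fps_nth (\<Sum>j\<le>n. fps_const (\<kappa> j) * U ^ j) i = (\<Sum>j\<le>n. \<kappa> j * fps_nth (U ^ j) i)"
    by (simp add: fps_sum_nth)
  also have "\<dots> = (\<Sum>j=0..i. \<kappa> j * fps_nth (U ^ j) i)"
    using startsby_zero_power_prefix[OF U0] i by (intro sum.mono_neutral_right) auto
  finally show "fps_nth (\<Sum>j\<le>n. fps_const (\<kappa> j) * U ^ j) i = fps_nth (Abs_fps \<kappa> oo U) i"
    by (simp add: fps_compose_nth)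
qed

text \<open>
An asymptotic analogue of solving a fixed-point equation by iteration. If \<open>g\<close> is known up to
\<open>o(w ^ n)\<close>, then so is \<open>k (g w)\<close>, and the factor \<open>w\<close> in \<open>g w = w * k (g w)\<close> gains one order. The outer
series may diverge, so its remainders are bounded order by order.
\<close>

lemma expands_fixed_point:
  fixes g k :: "real \<Rightarrow> real" and \<kappa> :: "nat \<Rightarrow> real"
  assumes g0: "(g \<longlongrightarrow> 0) (at_left 0)"
    and gneg: "\<And>w. w < 0 \<Longrightarrow> g w \<le> 0"
    and eq: "\<And>w. w < 0 \<Longrightarrow> g w = w * k (g w)"
    and k: "\<And>n x. x \<le> 0 \<Longrightarrow> \<bar>k x - (\<Sum>j\<le>n. \<kappa> j * x ^ j)\<bar> \<le> C n * \<bar>x\<bar> ^ Suc n"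
    and U: "U = fps_X * (Abs_fps \<kappa> oo U)"
  shows "expands g U n"
proof (induction n)
  have U0: "fps_nth U 0 = 0" by (subst U) simp
  case 0
  then show ?case using g0 U0 by (simp add: expands_def)
next
  have U0: "fps_nth U 0 = 0" by (subst U) simp
  have US: "fps_nth U (Suc i) = fps_nth (Abs_fps \<kappa> oo U) i" for i
    by (subst U) simp
  case (Suc n)
  let ?q = "\<lambda>w. \<Sum>j\<le>n. \<kappa> j * g w ^ j"
  let ?p = "\<lambda>w. \<Sum>i\<le>n. fps_nth (Abs_fps \<kappa> oo U) i * w ^ i"
  \<comment> \<open>So \<open>g w\<close> is of order \<open>w\<close>, and the remainder of order \<open>g ^ (n + 1)\<close> is \<open>o(w ^ n)\<close>.\<close>
  have quot: "((\<lambda>w. g w / w) \<longlongrightarrow> \<kappa> 0) (at_left 0)"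
  proof -
    have "((\<lambda>w. k (g w) - \<kappa> 0) \<longlongrightarrow> 0) (at_left 0)"
    proof (rule Lim_null_comparison)
      show "eventually (\<lambda>w. norm (k (g w) - \<kappa> 0) \<le> C 0 * \<bar>g w\<bar>) (at_left 0)"
        using eventually_at_left_0_neg by eventually_elim (use k[OF gneg, of _ 0] in simp)
      show "((\<lambda>w. C 0 * \<bar>g w\<bar>) \<longlongrightarrow> 0) (at_left 0)"
        using tendsto_mult[OF tendsto_const[of "C 0"] tendsto_rabs[OF g0]] by simp
    qed
    then have "((\<lambda>w. k (g w)) \<longlongrightarrow> \<kappa> 0) (at_left 0)" by (simp add: LIM_zero_iff)
    moreover have "eventually (\<lambda>w. k (g w) = g w / w) (at_left 0)"
      using eventually_at_left_0_neg by eventually_elim (use eq in \<open>simp add: field_simps\<close>)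
    ultimately show ?thesis by (simp cong: tendsto_cong)
  qed
  have "((\<lambda>w. (k (g w) - ?q w) / w ^ n) \<longlongrightarrow> 0) (at_left 0)"
  proof (rule Lim_null_comparison)
    show "eventually (\<lambda>w. norm ((k (g w) - ?q w) / w ^ n) \<le> C n * (\<bar>g w / w\<bar> ^ n * \<bar>g w\<bar>)) (at_left 0)"
      using eventually_at_left_0_neg
    proof eventually_elim
      case (elim w)
      have "norm ((k (g w) - ?q w) / w ^ n) \<le> C n * \<bar>g w\<bar> ^ Suc n / \<bar>w\<bar> ^ n"
        using k[OF gneg[OF elim], of n] by (simp add: abs_divide power_abs divide_right_mono)
      then show ?case by (simp add: abs_divide power_divide mult_ac)
    qed
    show "((\<lambda>w. C n * (\<bar>g w / w\<bar> ^ n * \<bar>g w\<bar>)) \<longlongrightarrow> 0) (at_left 0)"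
      using tendsto_mult[OF tendsto_const[of "C n"] tendsto_mult[OF tendsto_power[OF tendsto_rabs[OF quot], of n] tendsto_rabs[OF g0]]]
      by simp
  qed
  then have "((\<lambda>w. (k (g w) - ?q w) / w ^ n + (?q w - ?p w) / w ^ n) \<longlongrightarrow> 0 + 0) (at_left 0)"
    using expands_polynomial_compose[OF Suc.IH U0, of \<kappa>] unfolding expands_def by (rule tendsto_add)
  moreover have "eventually (\<lambda>w. (k (g w) - ?q w) / w ^ n + (?q w - ?p w) / w ^ n =
      (g w - (\<Sum>i\<le>Suc n. fps_nth U i * w ^ i)) / w ^ Suc n) (at_left 0)"
    using eventually_at_left_0_neg
  proof eventually_elim
    case (elim w)
    have "(\<Sum>i\<le>Suc n. fps_nth U i * w ^ i) = w * ?p w"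
      by (subst sum.atMost_Suc_shift) (simp add: U0 US sum_distrib_left mult_ac)
    then have "g w - (\<Sum>i\<le>Suc n. fps_nth U i * w ^ i) = w * (k (g w) - ?p w)"
      using eq[OF elim] by (simp add: algebra_simps)
    then show ?case using elim by (simp add: diff_divide_distrib)
  qed
  ultimately have "((\<lambda>w. (g w - (\<Sum>i\<le>Suc n. fps_nth U i * w ^ i)) / w ^ Suc n) \<longlongrightarrow> 0 + 0) (at_left 0)"
    by (rule Lim_transform_eventually)
  then show ?case unfolding expands_def by simp
qed

text \<open>
The geometric identity writes \<open>w ^ (k + 1) * t ^ k / (1 - w t)\<close> as the kernel \<open>w / (1 - w t)\<close> minus its
Taylor polynomial, whose integral is known by induction. Hence the integral of \<open>t ^ k / (1 - w t)\<close> is a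
remainder quotient of the expansion and tends to its \<open>k\<close>-th coefficient. For \<open>t \<ge> 0\<close> these integrands
increase to \<open>t ^ k\<close> as \<open>w\<close> increases to \<open>0\<close>, so monotone convergence gives integrability and the value at
once.
\<close>

lemma moments_of_expansion:
  assumes \<mu>: "real_distribution \<mu>" and pos: "AE t in \<mu>. 0 \<le> t"
    and ex: "\<And>n. expands (\<lambda>w. LINT t|\<mu>. w / (1 - w * t)) (fps_X * A) n"
  shows "integrable \<mu> (\<lambda>t. t ^ k) \<and> moment \<mu> k = fps_nth A k"
proof (induction k rule: less_induct)
  case (less k)
  interpret real_distribution \<mu> by fact
  let ?g = "\<lambda>w. LINT t|\<mu>. w / (1 - w * t)"
  have geom: "w ^ Suc k * (t ^ k / (1 - w * t)) = w / (1 - w * t) - (\<Sum>j<k. w ^ Suc j * t ^ j)"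
    if "w < 0" "0 \<le> t" for w t :: real
  proof -
    have "w * t \<le> 0" using that by (simp add: mult_nonpos_nonneg)
    then have "(\<Sum>j<k. (w * t) ^ j) = (1 - (w * t) ^ k) / (1 - w * t)" by (simp add: sum_gp_strict)
    moreover have "(\<Sum>j<k. w ^ Suc j * t ^ j) = w * (\<Sum>j<k. (w * t) ^ j)"
      by (simp add: sum_distrib_left power_mult_distrib mult_ac)
    ultimately have "w / (1 - w * t) - (\<Sum>j<k. w ^ Suc j * t ^ j) = w * ((w * t) ^ k / (1 - w * t))"
      by (simp only:) (simp add: diff_divide_distrib right_diff_distrib)
    then show ?thesis by (simp add: power_mult_distrib)
  qed
  have int1: "integrable \<mu> (\<lambda>t. w / (1 - w * t))" if w: "w < 0" for w
  proof (rule integrable_const_bound[where B = "\<bar>w\<bar>"])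
    show "AE t in \<mu>. norm (w / (1 - w * t)) \<le> \<bar>w\<bar>"
      using pos
    proof eventually_elim
      case (elim t)
      then have "w * t \<le> 0" using w by (simp add: mult_nonpos_nonneg)
      then show ?case by (simp add: abs_divide divide_le_eq mult_le_cancel_left1)
    qed
  qed simp
  have ints: "integrable \<mu> (\<lambda>t. w / (1 - w * t) - (\<Sum>j<k. w ^ Suc j * t ^ j))" if "w < 0" for w
    using int1[OF that] less.IH
    by (intro Bochner_Integration.integrable_diff Bochner_Integration.integrable_sum integrable_mult_right) auto
  have AEeq: "AE t in \<mu>. w / (1 - w * t) - (\<Sum>j<k. w ^ Suc j * t ^ j) = w ^ Suc k * (t ^ k / (1 - w * t))"
    if "w < 0" for w
    using pos by eventually_elim (use geom[OF that] in simp)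
  have int: "integrable \<mu> (\<lambda>t. t ^ k / (1 - w * t))" if w: "w < 0" for w
  proof -
    have "integrable \<mu> (\<lambda>t. w ^ Suc k * (t ^ k / (1 - w * t)))"
      by (rule integrable_cong_AE_imp[OF ints[OF w] _ AEeq[OF w]]) simp
    then have "integrable \<mu> (\<lambda>t. 1 / w ^ Suc k * (w ^ Suc k * (t ^ k / (1 - w * t))))"
      by (rule integrable_mult_right)
    then show ?thesis using w by simp
  qed
  have val: "(LINT t|\<mu>. t ^ k / (1 - w * t)) =
      (?g w - (\<Sum>i\<le>Suc k. fps_nth (fps_X * A) i * w ^ i)) / w ^ Suc k + fps_nth A k" if w: "w < 0" for w
  proof -
    have "w ^ Suc k * (LINT t|\<mu>. t ^ k / (1 - w * t)) = (LINT t|\<mu>. w ^ Suc k * (t ^ k / (1 - w * t)))"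
      by (rule integral_mult_right_zero[symmetric])
    also have "\<dots> = (LINT t|\<mu>. w / (1 - w * t) - (\<Sum>j<k. w ^ Suc j * t ^ j))"
      by (rule integral_cong_AE) (use AEeq[OF w] in auto)
    also have "\<dots> = ?g w - (\<Sum>j<k. w ^ Suc j * fps_nth A j)"
    proof -
      have i: "integrable \<mu> (\<lambda>t. w ^ Suc j * t ^ j)" if "j < k" for j
        using less.IH[OF that] by (intro integrable_mult_right) simp
      have "(LINT t|\<mu>. w / (1 - w * t) - (\<Sum>j<k. w ^ Suc j * t ^ j)) = ?g w - (LINT t|\<mu>. (\<Sum>j<k. w ^ Suc j * t ^ j))"
        using i by (intro Bochner_Integration.integral_diff int1 w Bochner_Integration.integrable_sum) simp
      also have "(LINT t|\<mu>. (\<Sum>j<k. w ^ Suc j * t ^ j)) = (\<Sum>j<k. LINT t|\<mu>. w ^ Suc j * t ^ j)"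
        using i by (intro Bochner_Integration.integral_sum) simp
      also have "\<dots> = (\<Sum>j<k. w ^ Suc j * fps_nth A j)"
        using less.IH by (intro sum.cong refl) (simp add: moment_def del: power_Suc)
      finally show ?thesis .
    qed
    also have "(\<Sum>j<k. w ^ Suc j * fps_nth A j) = (\<Sum>i\<le>Suc k. fps_nth (fps_X * A) i * w ^ i) - fps_nth A k * w ^ Suc k"
      by (subst sum.atMost_Suc_shift) (simp add: mult_ac flip: lessThan_Suc_atMost)
    finally show ?thesis using w by (simp add: field_simps)
  qed
  have lim: "((\<lambda>w. LINT t|\<mu>. t ^ k / (1 - w * t)) \<longlongrightarrow> fps_nth A k) (at_left 0)"
  proof -
    have "((\<lambda>w. (?g w - (\<Sum>i\<le>Suc k. fps_nth (fps_X * A) i * w ^ i)) / w ^ Suc k + fps_nth A k)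
        \<longlongrightarrow> 0 + fps_nth A k) (at_left 0)"
      using ex[of "Suc k"] unfolding expands_def by (intro tendsto_add tendsto_const)
    moreover have "eventually (\<lambda>w. (?g w - (\<Sum>i\<le>Suc k. fps_nth (fps_X * A) i * w ^ i)) / w ^ Suc k + fps_nth A k
        = (LINT t|\<mu>. t ^ k / (1 - w * t))) (at_left 0)"
      using eventually_at_left_0_neg by eventually_elim (simp only: val)
    ultimately have "((\<lambda>w. LINT t|\<mu>. t ^ k / (1 - w * t)) \<longlongrightarrow> 0 + fps_nth A k) (at_left 0)"
      by (rule Lim_transform_eventually)
    then show ?thesis by simp
  qed
  define w where "w n = - 1 / real (Suc n)" for n
  have wneg: "w n < 0" for n by (simp add: w_def)
  have w0: "w \<longlonglongrightarrow> 0"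
  proof -
    have "w = (\<lambda>n. - inverse (real (Suc n)))" by (rule ext) (simp add: w_def inverse_eq_divide)
    then show ?thesis using tendsto_minus[OF LIMSEQ_inverse_real_of_nat] by simp
  qed
  have wl: "filterlim w (at_left 0) sequentially"
    using w0 wneg by (simp add: filterlim_at less_imp_neq)
  have "has_bochner_integral \<mu> (\<lambda>t. t ^ k) (fps_nth A k)"
  proof (rule has_bochner_integral_monotone_convergence[where f = "\<lambda>n t. t ^ k / (1 - w n * t)"])
    show "(\<lambda>n. LINT t|\<mu>. t ^ k / (1 - w n * t)) \<longlonglongrightarrow> fps_nth A k"
      using filterlim_compose[OF lim wl] .
    show "AE t in \<mu>. mono (\<lambda>n. t ^ k / (1 - w n * t))"
      using pos
    proof eventually_elim
      case (elim t)
      show ?case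
      proof (rule monoI)
        fix m n :: nat assume "m \<le> n"
        then have "w m \<le> w n" by (simp add: w_def frac_le)
        then have "w m * t \<le> w n * t" using elim by (rule mult_right_mono)
        moreover have "w n * t \<le> 0" using elim wneg[of n] by (simp add: mult_nonpos_nonneg)
        ultimately show "t ^ k / (1 - w m * t) \<le> t ^ k / (1 - w n * t)"
          using elim by (intro divide_left_mono mult_pos_pos) auto
      qed
    qed
    have "(\<lambda>n. t ^ k / (1 - w n * t)) \<longlonglongrightarrow> t ^ k / (1 - 0 * t)" for t
      using w0 by (intro tendsto_intros) auto
    then show "AE t in \<mu>. (\<lambda>n. t ^ k / (1 - w n * t)) \<longlonglongrightarrow> t ^ k" by simp
  qed (use int wneg in auto)
  then show ?case by (simp add: moment_def has_bochner_integral_iff)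
qed

section \<open>The equation on the negative axis\<close>

text \<open>
Division by zero yields zero, so at a zero of the Stieltjes transform the equation would say that \<open>z\<close>
is the real number \<open>E [R]\<close>.
\<close>

lemma stieltjes_nonzero_of_equation:
  fixes R :: "'a \<Rightarrow> real"
  assumes z: "Im z > 0"
    and eq: "1 / stieltjes \<mu> z + z =
      (LINT \<omega>|M. complex_of_real (R \<omega>) / (1 + complex_of_real (c * R \<omega>) * stieltjes \<mu> z))"
  shows "stieltjes \<mu> z \<noteq> 0"
proof
  assume 0: "stieltjes \<mu> z = 0"
  have "z = complex_of_real (LINT \<omega>|M. R \<omega>)" using eq by (simp add: 0)
  then show False using z by simp
qed

text \<open>
On \<open>[0, \<infinity>)\<close> the kernel \<open>1 / (t - z)\<close> stays bounded as \<open>z\<close> descends vertically to the negative number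
\<open>1 / w\<close>, so the Stieltjes transform converges to \<open>- g\<close>. Along the way its real part is nonnegative,
which keeps the denominators \<open>1 + c R s\<close> at modulus at least \<open>1\<close> and allows dominated convergence on the
right-hand side.
\<close>

lemma boundary_equation:
  fixes R :: "'a \<Rightarrow> real"
  assumes \<mu>: "real_distribution \<mu>" and pos: "AE t in \<mu>. 0 \<le> t"
    and R: "integrable M R" "\<And>\<omega>. 0 \<le> R \<omega>" and c: "c > 0"
    and eq: "\<And>z. Im z > 0 \<Longrightarrow> 1 / stieltjes \<mu> z + z =
           (LINT \<omega>|M. complex_of_real (R \<omega>) / (1 + complex_of_real (c * R \<omega>) * stieltjes \<mu> z))"
    and w: "w < 0"
  defines "g \<equiv> LINT t|\<mu>. w / (1 - w * t)"
  shows "g \<le> 0" "\<bar>g\<bar> \<le> \<bar>w\<bar>" "g = w * (1 + (LINT \<omega>|M. R \<omega> * g / (1 - c * R \<omega> * g)))"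
proof -
  interpret real_distribution \<mu> by fact
  have [measurable]: "R \<in> borel_measurable M" using R by auto
  have bnd: "AE t in \<mu>. w / (1 - w * t) \<le> 0 \<and> \<bar>w / (1 - w * t)\<bar> \<le> \<bar>w\<bar>"
    using pos
  proof eventually_elim
    case (elim t)
    then have "w * t \<le> 0" using w by (simp add: mult_nonpos_nonneg)
    then have "\<bar>w / (1 - w * t)\<bar> \<le> \<bar>w\<bar>" by (simp add: abs_divide divide_le_eq mult_le_cancel_left1)
    with \<open>w * t \<le> 0\<close> show ?case using w by (simp add: divide_nonpos_pos)
  qed
  have "0 \<le> (LINT t|\<mu>. - (w / (1 - w * t)))"
    by (rule integral_nonneg_AE) (use bnd in auto)
  then show g: "g \<le> 0" by (simp add: g_def)
  have "integrable \<mu> (\<lambda>t. - (w / (1 - w * t)))"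
    by (rule integrable_const_bound[where B = "\<bar>w\<bar>"]) (use bnd in auto)
  then have "(LINT t|\<mu>. - (w / (1 - w * t))) \<le> \<bar>w\<bar>"
    by (rule integral_le_const) (use bnd in \<open>eventually_elim, linarith\<close>)
  then show "\<bar>g\<bar> \<le> \<bar>w\<bar>" using g by (simp add: g_def)
  define z where "z n = complex_of_real (1 / w) + \<i> * complex_of_real (1 / real (Suc n))" for n
  have z: "z \<longlonglongrightarrow> complex_of_real (1 / w)"
  proof -
    have "(\<lambda>n. 1 / real (Suc n)) \<longlonglongrightarrow> 0" using LIMSEQ_inverse_real_of_nat by (simp add: inverse_eq_divide)
    then have "z \<longlonglongrightarrow> complex_of_real (1 / w) + \<i> * complex_of_real 0"
      unfolding z_def by (intro tendsto_intros)
    then show ?thesis by simp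
  qed
  have Imz: "Im (z n) > 0" and Rez: "Re (z n) = 1 / w" for n by (simp_all add: z_def)
  have dist: "0 < - 1 / w" "- 1 / w \<le> t - 1 / w" if "0 \<le> t" for t using that w by (auto simp: field_simps mult_nonneg_nonpos)
  have kernel_bound: "cmod (1 / (complex_of_real t - z n)) \<le> \<bar>w\<bar>" if "0 \<le> t" for t n
  proof -
    have "- 1 / w \<le> \<bar>Re (complex_of_real t - z n)\<bar>" using dist[OF that] by (simp add: Rez)
    also have "\<dots> \<le> cmod (complex_of_real t - z n)" by (rule abs_Re_le_cmod)
    finally have "1 / cmod (complex_of_real t - z n) \<le> 1 / (- 1 / w)"
      using dist(1)[OF that] by (intro divide_left_mono mult_pos_pos) auto
    then show ?thesis using w by (simp add: norm_divide)
  qed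
  have int: "integrable \<mu> (\<lambda>t. 1 / (complex_of_real t - z n))" for n
    by (rule integrable_const_bound[where B = "\<bar>w\<bar>"]) (use pos kernel_bound in auto)
  have s: "(\<lambda>n. stieltjes \<mu> (z n)) \<longlonglongrightarrow> complex_of_real (- g)"
  proof -
    have "(\<lambda>n. stieltjes \<mu> (z n)) \<longlonglongrightarrow> (LINT t|\<mu>. complex_of_real (- (w / (1 - w * t))))"
      unfolding stieltjes_def
    proof (rule integral_dominated_convergence[where w = "\<lambda>_. \<bar>w\<bar>"])
      show "AE t in \<mu>. (\<lambda>n. 1 / (complex_of_real t - z n)) \<longlonglongrightarrow> complex_of_real (- (w / (1 - w * t)))"
        using pos
      proof eventually_elim
        case (elim t)
        have ne: "t - 1 / w \<noteq> 0" using dist[OF elim] by linarith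
        then have "complex_of_real t - complex_of_real (1 / w) \<noteq> 0" by (metis of_real_diff of_real_eq_0_iff)
        then have "(\<lambda>n. 1 / (complex_of_real t - z n)) \<longlonglongrightarrow> 1 / (complex_of_real t - complex_of_real (1 / w))"
          using z by (intro tendsto_intros)
        moreover have "1 / (t - 1 / w) = - (w / (1 - w * t))" using ne w by (simp add: field_simps)
        then have "1 / (complex_of_real t - complex_of_real (1 / w)) = complex_of_real (- (w / (1 - w * t)))"
          by (metis of_real_1 of_real_diff of_real_divide)
        ultimately show ?case by simp
      qed
    qed (use pos kernel_bound in auto)
    then show ?thesis by (simp only: integral_complex_of_real g_def Bochner_Integration.integral_minus)
  qed
  have Res: "Re (stieltjes \<mu> (z n)) \<ge> 0" for n
  proof -
    have "Re (stieltjes \<mu> (z n)) = (LINT t|\<mu>. Re (1 / (complex_of_real t - z n)))"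
      unfolding stieltjes_def using int by (rule integral_Re[symmetric])
    also have "\<dots> \<ge> 0"
    proof (rule integral_nonneg_AE)
      show "AE t in \<mu>. 0 \<le> Re (1 / (complex_of_real t - z n))"
        using pos
      proof eventually_elim
        case (elim t)
        have "0 \<le> t - 1 / w" using dist[OF elim] by linarith
        then show ?case by (simp add: Re_divide Rez)
      qed
    qed
    finally show ?thesis .
  qed
  have den: "cmod (1 + complex_of_real (c * R \<omega>) * stieltjes \<mu> (z n)) \<ge> 1" for \<omega> n
  proof -
    have "1 \<le> Re (1 + complex_of_real (c * R \<omega>) * stieltjes \<mu> (z n))" using Res[of n] R(2)[of \<omega>] c by simp
    also have "\<dots> \<le> cmod (1 + complex_of_real (c * R \<omega>) * stieltjes \<mu> (z n))" by (rule complex_Re_le_cmod)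
    finally show ?thesis .
  qed
  have E: "(\<lambda>n. LINT \<omega>|M. complex_of_real (R \<omega>) / (1 + complex_of_real (c * R \<omega>) * stieltjes \<mu> (z n)))
      \<longlonglongrightarrow> (LINT \<omega>|M. complex_of_real (R \<omega> / (1 - c * R \<omega> * g)))"
  proof (rule integral_dominated_convergence[where w = R])
    show "AE \<omega> in M. (\<lambda>n. complex_of_real (R \<omega>) / (1 + complex_of_real (c * R \<omega>) * stieltjes \<mu> (z n)))
        \<longlonglongrightarrow> complex_of_real (R \<omega> / (1 - c * R \<omega> * g))"
    proof (rule AE_I2)
      fix \<omega>
      have "c * R \<omega> * g \<le> 0" using c R(2)[of \<omega>] g by (simp add: mult_nonneg_nonpos)
      then have ne: "1 - c * R \<omega> * g \<noteq> 0" by linarith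
      have e: "1 + complex_of_real (c * R \<omega>) * complex_of_real (- g) = complex_of_real (1 - c * R \<omega> * g)" by simp
      have "(\<lambda>n. complex_of_real (R \<omega>) / (1 + complex_of_real (c * R \<omega>) * stieltjes \<mu> (z n)))
        \<longlonglongrightarrow> complex_of_real (R \<omega>) / (1 + complex_of_real (c * R \<omega>) * complex_of_real (- g))"
        by (intro tendsto_intros s) (use ne in \<open>simp only: e of_real_eq_0_iff not_False_eq_True\<close>)
      then show "(\<lambda>n. complex_of_real (R \<omega>) / (1 + complex_of_real (c * R \<omega>) * stieltjes \<mu> (z n)))
        \<longlonglongrightarrow> complex_of_real (R \<omega> / (1 - c * R \<omega> * g))" unfolding e by simp
    qed
    show "AE \<omega> in M. norm (complex_of_real (R \<omega>) / (1 + complex_of_real (c * R \<omega>) * stieltjes \<mu> (z n))) \<le> R \<omega>" for n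
    proof (rule AE_I2)
      fix \<omega>
      show "norm (complex_of_real (R \<omega>) / (1 + complex_of_real (c * R \<omega>) * stieltjes \<mu> (z n))) \<le> R \<omega>"
        using frac_le[OF R(2)[of \<omega>] order_refl zero_less_one den[of \<omega> n]] R(2)[of \<omega>] by (simp add: norm_divide)
    qed
  qed (use R in auto)
  have s0: "stieltjes \<mu> (z n) \<noteq> 0" for n
    using stieltjes_nonzero_of_equation[OF Imz eq[OF Imz]] .
  \<comment> \<open>The equation is multiplied by \<open>s\<close> before passing to the limit, since the limit \<open>- g\<close> is not yet known to be nonzero.\<close>
  have prod: "1 + z n * stieltjes \<mu> (z n) = stieltjes \<mu> (z n) *
      (LINT \<omega>|M. complex_of_real (R \<omega>) / (1 + complex_of_real (c * R \<omega>) * stieltjes \<mu> (z n)))" for n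
    unfolding eq[OF Imz[of n], symmetric] using s0[of n] by (simp add: field_simps)
  have "(\<lambda>n. 1 + z n * stieltjes \<mu> (z n)) \<longlonglongrightarrow> 1 + complex_of_real (1 / w) * complex_of_real (- g)"
    by (intro tendsto_intros z s)
  moreover have "(\<lambda>n. 1 + z n * stieltjes \<mu> (z n)) \<longlonglongrightarrow>
      complex_of_real (- g) * (LINT \<omega>|M. complex_of_real (R \<omega> / (1 - c * R \<omega> * g)))"
    unfolding prod by (intro tendsto_intros s E)
  ultimately have "1 + complex_of_real (1 / w) * complex_of_real (- g) =
      complex_of_real (- g) * (LINT \<omega>|M. complex_of_real (R \<omega> / (1 - c * R \<omega> * g)))"
    by (rule LIMSEQ_unique)
  then have "complex_of_real (1 + 1 / w * - g) = complex_of_real (- g * (LINT \<omega>|M. R \<omega> / (1 - c * R \<omega> * g)))"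
    by (simp only: integral_complex_of_real of_real_add of_real_mult of_real_1)
  then have "1 + 1 / w * - g = - g * (LINT \<omega>|M. R \<omega> / (1 - c * R \<omega> * g))"
    by (simp only: of_real_eq_iff)
  then have "g = w * (1 + g * (LINT \<omega>|M. R \<omega> / (1 - c * R \<omega> * g)))" using w by (simp add: field_simps)
  also have "g * (LINT \<omega>|M. R \<omega> / (1 - c * R \<omega> * g)) = (LINT \<omega>|M. R \<omega> * g / (1 - c * R \<omega> * g))"
    by (subst integral_mult_right_zero[symmetric]) (simp add: mult_ac)
  finally show "g = w * (1 + (LINT \<omega>|M. R \<omega> * g / (1 - c * R \<omega> * g)))" .
qed

text \<open>
The finite geometric series under the expectation; for \<open>x \<le> 0\<close> the denominator is at least \<open>1\<close>, so the
remainder is bounded by its numerator. This supplies the remainder bounds that \<open>expands_fixed_point\<close>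
asks for.
\<close>

lemma cumulant_series_remainder:
  fixes R :: "'a \<Rightarrow> real"
  assumes R: "\<And>k. integrable M (\<lambda>\<omega>. R \<omega> ^ k)" "\<And>\<omega>. 0 \<le> R \<omega>" and c: "c > 0" and x: "x \<le> 0"
  shows "\<bar>1 + (LINT \<omega>|M. R \<omega> * x / (1 - c * R \<omega> * x)) -
      (\<Sum>j\<le>n. (if j = 0 then 1 else c ^ (j - 1) * (LINT \<omega>|M. R \<omega> ^ j)) * x ^ j)\<bar>
    \<le> c ^ n * (LINT \<omega>|M. R \<omega> ^ Suc n) * \<bar>x\<bar> ^ Suc n"
proof -
  have den: "1 - c * R \<omega> * x \<ge> 1" for \<omega>
    using mult_nonneg_nonpos[of "c * R \<omega>" x] c R(2)[of \<omega>] x by simp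
  have [measurable]: "R \<in> borel_measurable M" using R(1)[of 1] by simp
  define rem where "rem \<omega> = c ^ n * R \<omega> ^ Suc n * x ^ Suc n / (1 - c * R \<omega> * x)" for \<omega>
  have rem_bound: "\<bar>rem \<omega>\<bar> \<le> c ^ n * R \<omega> ^ Suc n * \<bar>x\<bar> ^ Suc n" for \<omega>
  proof -
    have "\<bar>rem \<omega>\<bar> = c ^ n * R \<omega> ^ Suc n * \<bar>x\<bar> ^ Suc n / (1 - c * R \<omega> * x)"
      using den[of \<omega>] c R(2)[of \<omega>] by (simp add: rem_def abs_divide abs_mult power_abs)
    also have "\<dots> \<le> c ^ n * R \<omega> ^ Suc n * \<bar>x\<bar> ^ Suc n / 1"
      using den[of \<omega>] c R(2)[of \<omega>] by (intro divide_left_mono) auto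
    finally show ?thesis by simp
  qed
  have bint: "integrable M (\<lambda>\<omega>. c ^ n * R \<omega> ^ Suc n * \<bar>x\<bar> ^ Suc n)" using R(1)[of "Suc n"] by simp
  have rint: "integrable M rem"
  proof (rule Bochner_Integration.integrable_bound[OF bint])
    show "rem \<in> borel_measurable M" unfolding rem_def by measurable
    show "AE \<omega> in M. norm (rem \<omega>) \<le> norm (c ^ n * R \<omega> ^ Suc n * \<bar>x\<bar> ^ Suc n)"
      unfolding real_norm_def by (intro AE_I2 order_trans[OF rem_bound abs_ge_self])
  qed
  have geom: "R \<omega> * x / (1 - c * R \<omega> * x) = (\<Sum>j<n. c ^ j * x ^ Suc j * R \<omega> ^ Suc j) + rem \<omega>" for \<omega>
  proof -
    have "(\<Sum>j<n. (c * R \<omega> * x) ^ j) = (1 - (c * R \<omega> * x) ^ n) / (1 - c * R \<omega> * x)"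
      using den[of \<omega>] by (simp add: sum_gp_strict)
    moreover have "(\<Sum>j<n. c ^ j * x ^ Suc j * R \<omega> ^ Suc j) = R \<omega> * x * (\<Sum>j<n. (c * R \<omega> * x) ^ j)"
      by (simp add: sum_distrib_left power_mult_distrib mult_ac)
    moreover have "rem \<omega> = R \<omega> * x * ((c * R \<omega> * x) ^ n / (1 - c * R \<omega> * x))"
      by (simp add: rem_def power_mult_distrib mult_ac)
    ultimately have "(\<Sum>j<n. c ^ j * x ^ Suc j * R \<omega> ^ Suc j) + rem \<omega> =
        R \<omega> * x * ((1 - (c * R \<omega> * x) ^ n) / (1 - c * R \<omega> * x) + (c * R \<omega> * x) ^ n / (1 - c * R \<omega> * x))"
      by (simp only: distrib_left)
    then show ?thesis by (simp flip: add_divide_distrib)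
  qed
  have "(LINT \<omega>|M. R \<omega> * x / (1 - c * R \<omega> * x)) =
      (\<Sum>j<n. c ^ j * x ^ Suc j * (LINT \<omega>|M. R \<omega> ^ Suc j)) + (LINT \<omega>|M. rem \<omega>)"
    unfolding geom using R(1) rint by (subst Bochner_Integration.integral_add) (auto simp del: power_Suc)
  moreover have "(\<Sum>j\<le>n. (if j = 0 then 1 else c ^ (j - 1) * (LINT \<omega>|M. R \<omega> ^ j)) * x ^ j) =
      1 + (\<Sum>j<n. c ^ j * x ^ Suc j * (LINT \<omega>|M. R \<omega> ^ Suc j))"
    by (simp add: sum.atMost_shift mult_ac)
  ultimately have "1 + (LINT \<omega>|M. R \<omega> * x / (1 - c * R \<omega> * x)) -
      (\<Sum>j\<le>n. (if j = 0 then 1 else c ^ (j - 1) * (LINT \<omega>|M. R \<omega> ^ j)) * x ^ j) = (LINT \<omega>|M. rem \<omega>)"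
    by simp
  also have "\<bar>\<dots>\<bar> \<le> (LINT \<omega>|M. \<bar>rem \<omega>\<bar>)" by (rule integral_abs_bound)
  also have "\<dots> \<le> (LINT \<omega>|M. c ^ n * R \<omega> ^ Suc n * \<bar>x\<bar> ^ Suc n)"
    by (rule integral_mono) (use rint bint rem_bound in auto)
  finally show ?thesis by simp
qed

text \<open>
The asymptotic expansion of \<open>g\<close> on the negative axis, with the formal solution given by noncrossing
partitions.
\<close>

lemma moments_of_equation:
  fixes R :: "'a \<Rightarrow> real"
  assumes \<mu>: "real_distribution \<mu>" and pos: "AE t in \<mu>. 0 \<le> t"
    and R: "\<And>k. integrable M (\<lambda>\<omega>. R \<omega> ^ k)" "\<And>\<omega>. 0 \<le> R \<omega>" and c: "c > 0"
    and eq: "\<And>z. Im z > 0 \<Longrightarrow> 1 / stieltjes \<mu> z + z =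
           (LINT \<omega>|M. complex_of_real (R \<omega>) / (1 + complex_of_real (c * R \<omega>) * stieltjes \<mu> z))"
  shows "integrable \<mu> (\<lambda>t. t ^ k)"
    "moment \<mu> k = (\<Sum>P\<in>NC k. \<Prod>V\<in>P. c ^ (card V - 1) * (LINT \<omega>|M. R \<omega> ^ card V))"
proof -
  define \<kappa> where "\<kappa> j = (if j = 0 then 1 else c ^ (j - 1) * (LINT \<omega>|M. R \<omega> ^ j))" for j
  define A where "A = Abs_fps (\<lambda>n. \<Sum>P\<in>ncp 0 n. \<Prod>V\<in>P. \<kappa> (card V))"
  let ?g = "\<lambda>w. LINT t|\<mu>. w / (1 - w * t)"
  have k0: "\<kappa> 0 = 1" by (simp add: \<kappa>_def)
  have R1: "integrable M R" using R(1)[of 1] by simp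
  note b = boundary_equation[OF \<mu> pos R1 R(2) c eq]
  have "expands ?g (fps_X * A) n" for n
  proof (rule expands_fixed_point[where k = "\<lambda>x. 1 + (LINT \<omega>|M. R \<omega> * x / (1 - c * R \<omega> * x))"
        and \<kappa> = \<kappa> and C = "\<lambda>n. c ^ n * (LINT \<omega>|M. R \<omega> ^ Suc n)"])
    show "(?g \<longlongrightarrow> 0) (at_left 0)"
    proof (rule Lim_null_comparison)
      show "eventually (\<lambda>w. norm (?g w) \<le> \<bar>w\<bar>) (at_left 0)"
        using eventually_at_left_0_neg by eventually_elim (use b(2) in simp)
      show "((\<lambda>w::real. \<bar>w\<bar>) \<longlongrightarrow> 0) (at_left 0)" by (intro tendsto_rabs_zero tendsto_ident_at)
    qed
    show "fps_X * A = fps_X * (Abs_fps \<kappa> oo (fps_X * A))"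
      using nc_fps_compose[of \<kappa>, OF k0] by (simp add: A_def)
    show "\<bar>1 + (LINT \<omega>|M. R \<omega> * x / (1 - c * R \<omega> * x)) - (\<Sum>j\<le>n. \<kappa> j * x ^ j)\<bar>
        \<le> c ^ n * (LINT \<omega>|M. R \<omega> ^ Suc n) * \<bar>x\<bar> ^ Suc n" if "x \<le> 0" for n x
      unfolding \<kappa>_def by (rule cumulant_series_remainder[OF R c that])
  qed (use b in auto)
  from moments_of_expansion[OF \<mu> pos this]
  have m: "integrable \<mu> (\<lambda>t. t ^ k) \<and> moment \<mu> k = fps_nth A k" .
  then show "integrable \<mu> (\<lambda>t. t ^ k)" by blast
  have "moment \<mu> k = (\<Sum>P\<in>NC k. \<Prod>V\<in>P. \<kappa> (card V))"
    using m nc_sum_shift[of \<kappa> 1 k, OF k0] by (simp add: A_def NC_eq_ncp)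
  also have "\<dots> = (\<Sum>P\<in>NC k. \<Prod>V\<in>P. c ^ (card V - 1) * (LINT \<omega>|M. R \<omega> ^ card V))"
    by (intro sum.cong prod.cong refl) (use NC_partition(4) in \<open>force simp: \<kappa>_def\<close>)
  finally show "moment \<mu> k = (\<Sum>P\<in>NC k. \<Prod>V\<in>P. c ^ (card V - 1) * (LINT \<omega>|M. R \<omega> ^ card V))" .
qed

section \<open>The Voiculescu transform\<close>

text \<open>
Difference quotients of the kernel equal \<open>f / ((X - y) (X - z))\<close>, which is dominated by a multiple of
\<open>\<bar>f\<bar>\<close> as long as \<open>y\<close> and \<open>z\<close> stay away from the real axis. The lemma covers both the Stieltjes transform
and the candidate for the Voiculescu transform.
\<close>

lemma stieltjes_integral_holomorphic:
  fixes f X :: "'a \<Rightarrow> real"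
  assumes f: "integrable M f" and X: "X \<in> borel_measurable M"
  shows "(\<lambda>z. LINT \<omega>|M. complex_of_real (f \<omega>) / (complex_of_real (X \<omega>) - z)) holomorphic_on {z. 0 < Im z}"
proof -
  let ?k = "\<lambda>z \<omega>. complex_of_real (f \<omega>) / (complex_of_real (X \<omega>) - z)"
  let ?k' = "\<lambda>z \<omega>. complex_of_real (f \<omega>) / (complex_of_real (X \<omega>) - z)\<^sup>2"
  have [measurable]: "f \<in> borel_measurable M" using f by simp
  note [measurable] = X
  have low: "Im z \<le> cmod (complex_of_real x - z)" if "0 < Im z" for x z
    using abs_Im_le_cmod[of "complex_of_real x - z"] that by simp
  have ne: "complex_of_real x - z \<noteq> 0" if "0 < Im z" for x z
    using low[OF that, of x] that by auto
  have int: "integrable M (?k z)" if z: "0 < Im z" for z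
  proof (rule Bochner_Integration.integrable_bound)
    show "integrable M (\<lambda>\<omega>. \<bar>f \<omega>\<bar> / Im z)" using f by simp
    show "AE \<omega> in M. norm (?k z \<omega>) \<le> norm (\<bar>f \<omega>\<bar> / Im z)"
    proof (rule AE_I2)
      fix \<omega>
      have "\<bar>f \<omega>\<bar> / cmod (complex_of_real (X \<omega>) - z) \<le> \<bar>f \<omega>\<bar> / Im z"
        using low[OF z, of "X \<omega>"] z by (intro divide_left_mono mult_pos_pos) auto
      then show "norm (?k z \<omega>) \<le> norm (\<bar>f \<omega>\<bar> / Im z)" using z by (simp add: norm_divide)
    qed
  qed simp
  show ?thesis
    unfolding holomorphic_on_open[OF open_halfspace_Im_gt[of 0]]
  proof
    fix z assume "z \<in> {z. 0 < Im z}"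
    then have z: "0 < Im z" by simp
    have "((\<lambda>y. (LINT \<omega>|M. ?k y \<omega>)) has_field_derivative (LINT \<omega>|M. ?k' z \<omega>)) (at z)"
      unfolding has_field_derivative_iff tendsto_at_iff_sequentially comp_def
    proof (intro allI impI)
      fix y :: "nat \<Rightarrow> complex"
      assume yz: "\<forall>i. y i \<in> UNIV - {z}" and y: "y \<longlonglongrightarrow> z"
      let ?e = "Im z / 2"
      have e: "0 < ?e" using z by simp
      have "eventually (\<lambda>i. ?e < Im (y i)) sequentially"
        using tendsto_Im[OF y] z by (intro order_tendstoD(1)) auto
      then obtain N where N: "\<And>i. i \<ge> N \<Longrightarrow> ?e < Im (y i)" by (auto simp: eventually_sequentially)
      let ?q = "\<lambda>i \<omega>. complex_of_real (f \<omega>) / ((complex_of_real (X \<omega>) - y (i + N)) * (complex_of_real (X \<omega>) - z))"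
      have q: "((LINT \<omega>|M. ?k (y (i + N)) \<omega>) - (LINT \<omega>|M. ?k z \<omega>)) / (y (i + N) - z) = (LINT \<omega>|M. ?q i \<omega>)" for i
      proof -
        have p: "0 < Im (y (i + N))" using N[of "i + N"] e by simp
        have "(LINT \<omega>|M. ?k (y (i + N)) \<omega>) - (LINT \<omega>|M. ?k z \<omega>) = (LINT \<omega>|M. ?k (y (i + N)) \<omega> - ?k z \<omega>)"
          using int p z by simp
        also have "\<dots> = (LINT \<omega>|M. (y (i + N) - z) * ?q i \<omega>)"
          using ne[OF p] ne[OF z] by (intro Bochner_Integration.integral_cong) (auto simp: field_simps)
        also have "\<dots> = (y (i + N) - z) * (LINT \<omega>|M. ?q i \<omega>)" by (rule integral_mult_right_zero)
        finally show ?thesis using yz by simp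
      qed
      have "(\<lambda>i. LINT \<omega>|M. ?q i \<omega>) \<longlonglongrightarrow> (LINT \<omega>|M. ?k' z \<omega>)"
      proof (rule integral_dominated_convergence[where w = "\<lambda>\<omega>. \<bar>f \<omega>\<bar> / (?e * ?e)"])
        show "AE \<omega> in M. (\<lambda>i. ?q i \<omega>) \<longlonglongrightarrow> ?k' z \<omega>"
        proof (rule AE_I2)
          fix \<omega>
          show "(\<lambda>i. ?q i \<omega>) \<longlonglongrightarrow> ?k' z \<omega>"
            unfolding power2_eq_square using LIMSEQ_ignore_initial_segment[OF y, of N] ne[OF z]
            by (intro tendsto_intros) auto
        qed
        show "AE \<omega> in M. norm (?q i \<omega>) \<le> \<bar>f \<omega>\<bar> / (?e * ?e)" for i
        proof (rule AE_I2)
          fix \<omega>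
          have p: "?e \<le> Im (y (i + N))" "0 < Im (y (i + N))" using N[of "i + N"] e by auto
          have "?e * ?e \<le> cmod (complex_of_real (X \<omega>) - y (i + N)) * cmod (complex_of_real (X \<omega>) - z)"
            using low[OF p(2), of "X \<omega>"] low[OF z, of "X \<omega>"] p(1) z by (intro mult_mono) auto
          then show "norm (?q i \<omega>) \<le> \<bar>f \<omega>\<bar> / (?e * ?e)"
            using e ne[OF p(2)] ne[OF z] unfolding norm_divide norm_mult norm_of_real
            by (intro divide_left_mono mult_pos_pos) auto
        qed
      qed (use f in auto)
      then have "(\<lambda>i. ((LINT \<omega>|M. ?k (y (i + N)) \<omega>) - (LINT \<omega>|M. ?k z \<omega>)) / (y (i + N) - z)) \<longlonglongrightarrow> (LINT \<omega>|M. ?k' z \<omega>)"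
        unfolding q .
      then show "(\<lambda>i. ((LINT \<omega>|M. ?k (y i) \<omega>) - (LINT \<omega>|M. ?k z \<omega>)) / (y i - z)) \<longlonglongrightarrow> (LINT \<omega>|M. ?k' z \<omega>)"
        by (rule LIMSEQ_offset)
    qed
    then show "\<exists>f'. ((\<lambda>z. LINT \<omega>|M. ?k z \<omega>) has_field_derivative f') (at z)" by blast
  qed
qed

lemma stieltjes_holomorphic:
  assumes "real_distribution \<mu>"
  shows "stieltjes \<mu> holomorphic_on {z. 0 < Im z}"
proof -
  interpret real_distribution \<mu> by fact
  show ?thesis
    using stieltjes_integral_holomorphic[of \<mu> "\<lambda>_. 1" "\<lambda>t. t"]
    by (simp add: stieltjes_def[abs_def])
qed

text \<open>
The integrand \<open>- z / (t - z)\<close> has modulus at most \<open>1\<close> on the imaginary axis and tends to \<open>1\<close>. This is what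
brings the image of \<open>F\<close> into every truncated cone.
\<close>

lemma stieltjes_imaginary_axis:
  assumes "real_distribution \<mu>"
  shows "(\<lambda>n. - (\<i> * of_nat (Suc n)) * stieltjes \<mu> (\<i> * of_nat (Suc n))) \<longlonglongrightarrow> 1"
proof -
  interpret real_distribution \<mu> by fact
  let ?z = "\<lambda>n. \<i> * of_nat (Suc n) :: complex"
  have "(\<lambda>n. LINT t|\<mu>. - ?z n / (complex_of_real t - ?z n)) \<longlonglongrightarrow> (LINT t|\<mu>. 1)"
  proof (rule integral_dominated_convergence[where w = "\<lambda>_. 1"])
    have low: "cmod (?z n) \<le> cmod (complex_of_real t - ?z n)" for t n
      using abs_Im_le_cmod[of "complex_of_real t - ?z n"] by (simp add: norm_mult del: of_nat_Suc)
    show "AE t in \<mu>. norm (- ?z n / (complex_of_real t - ?z n)) \<le> 1" for n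
      using low[of n] by (intro AE_I2) (simp add: norm_divide divide_le_eq_1 del: of_nat_Suc)
    show "AE t in \<mu>. (\<lambda>n. - ?z n / (complex_of_real t - ?z n)) \<longlonglongrightarrow> 1"
    proof (rule AE_I2)
      fix t
      have inv0: "(\<lambda>n. inverse (of_nat (Suc n)) :: complex) \<longlonglongrightarrow> 0"
        using tendsto_of_real[OF LIMSEQ_inverse_real_of_nat, where 'a = complex]
        by (simp only: of_real_inverse of_real_of_nat_eq of_real_0)
      have "(\<lambda>n. 1 / (1 + \<i> * complex_of_real t * inverse (of_nat (Suc n)))) \<longlonglongrightarrow> 1 / (1 + \<i> * complex_of_real t * 0)"
        by (intro tendsto_intros inv0) auto
      moreover have "1 / (1 + \<i> * complex_of_real t * inverse (of_nat (Suc n))) = - ?z n / (complex_of_real t - ?z n)" for n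
      proof -
        have "complex_of_real t - ?z n = - ?z n * (1 + \<i> * complex_of_real t * inverse (of_nat (Suc n)))"
          by (simp add: field_simps del: of_nat_Suc)
        moreover have "- ?z n \<noteq> 0" by (simp del: of_nat_Suc)
        ultimately show ?thesis by (metis nonzero_divide_mult_cancel_left)
      qed
      ultimately show "(\<lambda>n. - ?z n / (complex_of_real t - ?z n)) \<longlonglongrightarrow> 1" by simp
    qed
  qed simp_all
  moreover have "(LINT t|\<mu>. - ?z n / (complex_of_real t - ?z n)) = - ?z n * stieltjes \<mu> (?z n)" for n
    unfolding stieltjes_def by (subst integral_mult_right_zero[symmetric]) simp
  ultimately show ?thesis by (simp add: prob_space[simplified] del: of_nat_Suc)
qed

lemma truncated_cone_open_connected: "open (truncated_cone \<alpha> \<beta>)" "connected (truncated_cone \<alpha> \<beta>)"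
proof -
  have e: "truncated_cone \<alpha> \<beta> = {z. Im z > \<beta>} \<inter> {z. Re z < \<alpha> * Im z} \<inter> {z. - Re z < \<alpha> * Im z}"
    by (auto simp: truncated_cone_def)
  show "open (truncated_cone \<alpha> \<beta>)"
    unfolding e by (intro open_Int open_Collect_less continuous_intros)
  have "convex (truncated_cone \<alpha> \<beta>)"
  proof (rule convexI)
    fix x y and u v :: real
    assume x: "x \<in> truncated_cone \<alpha> \<beta>" and y: "y \<in> truncated_cone \<alpha> \<beta>" and u: "0 \<le> u" "0 \<le> v" "u + v = 1"
    have comb: "u * a + v * b > 0" if "a > 0" "b > 0" for a b :: real
    proof (cases "u = 0")
      case True then show ?thesis using that u by simp
    next
      case False
      then have "u * a > 0" using that u by simp
      moreover have "v * b \<ge> 0" using that u by simp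
      ultimately show ?thesis by linarith
    qed
    have "u * (Im x - \<beta>) + v * (Im y - \<beta>) > 0" using x y by (intro comb) (auto simp: truncated_cone_def)
    moreover have "u * \<beta> + v * \<beta> = \<beta>" using u by (simp flip: distrib_right)
    moreover have "u * (\<alpha> * Im x - Re x) + v * (\<alpha> * Im y - Re y) > 0" "u * (\<alpha> * Im x + Re x) + v * (\<alpha> * Im y + Re y) > 0"
      using x y by (intro comb; auto simp: truncated_cone_def)+
    ultimately show "u *\<^sub>R x + v *\<^sub>R y \<in> truncated_cone \<alpha> \<beta>"
      by (simp add: truncated_cone_def abs_less_iff algebra_simps)
  qed
  then show "connected (truncated_cone \<alpha> \<beta>)" by (rule convex_connected)
qed

text \<open>
Where the image of \<open>F\<close> meets the cone, \<open>h\<close> is the inverse of \<open>F\<close> on both sides. The intersection is open,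
as \<open>F\<close> is injective and holomorphic, and nonempty, as \<open>F z / z\<close> tends to \<open>1\<close> along the imaginary axis.
Since \<open>F \<circ> h\<close> is holomorphic on the connected cone, the identity theorem extends the
relation \<open>F (h \<zeta>) = \<zeta>\<close> to all of it.
\<close>

lemma right_inverse_of_left_inverse:
  assumes \<mu>: "real_distribution \<mu>" and \<alpha>: "\<alpha> > 0"
    and s0: "\<And>z. Im z > 0 \<Longrightarrow> stieltjes \<mu> z \<noteq> 0"
    and inj: "inj_on (stieltjes \<mu>) {z. Im z > 0}"
    and left: "\<And>z. Im z > 0 \<Longrightarrow> reciprocal_cauchy \<mu> z \<in> truncated_cone \<alpha> \<beta> \<Longrightarrow> h (reciprocal_cauchy \<mu> z) = z"
    and hol: "h holomorphic_on truncated_cone \<alpha> \<beta>"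
    and Imh: "\<And>\<zeta>. \<zeta> \<in> truncated_cone \<alpha> \<beta> \<Longrightarrow> Im (h \<zeta>) > 0"
    and \<zeta>: "\<zeta> \<in> truncated_cone \<alpha> \<beta>"
  shows "reciprocal_cauchy \<mu> (h \<zeta>) = \<zeta>"
proof -
  let ?F = "reciprocal_cauchy \<mu>" and ?D = "truncated_cone \<alpha> \<beta>" and ?H = "{z. 0 < Im z}"
  have F: "?F z = - 1 / stieltjes \<mu> z" for z by (simp add: reciprocal_cauchy_def cauchy_transform_def)
  have Fhol: "?F holomorphic_on ?H"
    unfolding F by (intro holomorphic_intros stieltjes_holomorphic \<mu>) (use s0 in auto)
  have Finj: "inj_on ?F ?H"
    using inj s0 unfolding inj_on_def F by (auto simp: field_simps)
  have "open (?F ` ?H)" by (rule open_mapping_thm3[OF Fhol open_halfspace_Im_gt[of 0] Finj])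
  then have op: "open (?F ` ?H \<inter> ?D)" using truncated_cone_open_connected by blast
  let ?z = "\<lambda>n. \<i> * of_nat (Suc n) :: complex"
  have "\<exists>n. ?F (?z n) \<in> ?D"
  proof -
    have "(\<lambda>n. inverse (- ?z n * stieltjes \<mu> (?z n))) \<longlonglongrightarrow> inverse 1"
      using stieltjes_imaginary_axis[OF \<mu>] by (rule tendsto_inverse) simp
    moreover have "inverse (- ?z n * stieltjes \<mu> (?z n)) = ?F (?z n) / ?z n" for n
      unfolding F by (simp add: field_simps del: of_nat_Suc)
    ultimately have lim: "(\<lambda>n. ?F (?z n) / ?z n) \<longlonglongrightarrow> 1" by simp
    have "eventually (\<lambda>n. Re (?F (?z n) / ?z n) > 1 / 2) sequentially"
      using tendsto_Re[OF lim] by (intro order_tendstoD(1)) auto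
    moreover have "eventually (\<lambda>n. \<bar>Im (?F (?z n) / ?z n)\<bar> < \<alpha> / 2) sequentially"
      using tendsto_rabs[OF tendsto_Im[OF lim]] \<alpha> by (intro order_tendstoD(2)) auto
    moreover have "eventually (\<lambda>n. real n > 2 * \<beta>) sequentially"
      using filterlim_real_sequentially by (simp add: filterlim_at_top_dense)
    \<comment> \<open>With \<open>F (\<i> N) = \<i> N u\<close>, the bounds \<open>Re u > 1 / 2\<close> and \<open>\<bar>Im u\<bar> < \<alpha> / 2\<close> place \<open>F (\<i> N)\<close> in the cone of aperture \<open>\<alpha>\<close>.\<close>
    ultimately have "eventually (\<lambda>n. ?F (?z n) \<in> ?D) sequentially"
    proof eventually_elim
      case (elim n)
      define u where "u = ?F (?z n) / ?z n"
      define N where "N = real (Suc n)"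
      have Nz: "?z n = \<i> * complex_of_real N" by (simp add: N_def)
      have N: "N > 0" "N > 2 * \<beta>" using elim(3) by (simp_all add: N_def)
      have Fu: "?F (?z n) = \<i> * complex_of_real N * u" 
        using N unfolding u_def Nz by simp
      have u: "Re u > 1 / 2" "\<bar>Im u\<bar> < \<alpha> / 2" using elim(1,2) by (simp_all only: u_def)
      have "\<beta> < N * (1 / 2)" using N by simp
      also have "\<dots> < N * Re u" using N u by (intro mult_strict_left_mono) auto
      finally have 1: "\<beta> < N * Re u" .
      have "\<bar>Im u\<bar> < \<alpha> * (1 / 2)" using u by simp
      also have "\<dots> < \<alpha> * Re u" using \<alpha> u by (intro mult_strict_left_mono) auto
      finally have "N * \<bar>Im u\<bar> < N * (\<alpha> * Re u)" using N by (intro mult_strict_left_mono) auto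
      with 1 N show ?case unfolding Fu truncated_cone_def by (simp add: abs_mult mult_ac)
    qed
    then show ?thesis by (auto simp: eventually_sequentially)
  qed
  then obtain n where "?F (?z n) \<in> ?D" by blast
  moreover have "?z n \<in> ?H" by simp
  ultimately have ne: "?F ` ?H \<inter> ?D \<noteq> {}" by blast
  have "(\<lambda>\<zeta>. ?F (h \<zeta>)) \<zeta> = (\<lambda>\<zeta>. \<zeta>) \<zeta>"
  proof (rule analytic_continuation_open[OF op truncated_cone_open_connected(1) ne truncated_cone_open_connected(2)])
    show "(\<lambda>\<zeta>. ?F (h \<zeta>)) holomorphic_on ?D"
      using holomorphic_on_compose_gen[OF hol Fhol] Imh by (auto simp: o_def)
    show "?F (h \<zeta>) = \<zeta>" if "\<zeta> \<in> ?F ` ?H \<inter> ?D" for \<zeta>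
      using that left by auto
  qed (use \<zeta> in auto)
  then show ?thesis .
qed

text \<open>
Substituting \<open>s = - 1 / F\<close> turns the equation into \<open>F z + \<phi> (F z) = z\<close>, and it also shows that \<open>s z\<close>
determines \<open>z\<close>, so \<open>F\<close> is injective. The rest is the estimate that makes \<open>\<phi>\<close> bounded on cones.
\<close>

lemma free_compound_Poisson_of_equation:
  fixes R :: "'a \<Rightarrow> real"
  assumes \<mu>: "real_distribution \<mu>" and M: "prob_space M"
    and R: "integrable M R" "\<And>\<omega>. 0 \<le> R \<omega>" and c: "c > 0"
    and eq: "\<And>z. Im z > 0 \<Longrightarrow> 1 / stieltjes \<mu> z + z =
           (LINT \<omega>|M. complex_of_real (R \<omega>) / (1 + complex_of_real (c * R \<omega>) * stieltjes \<mu> z))"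
  shows "is_free_compound_Poisson (1 / c) (distr M borel (\<lambda>\<omega>. c * R \<omega>)) \<mu>"
proof -
  interpret M: prob_space M by fact
  let ?\<rho> = "distr M borel (\<lambda>\<omega>. c * R \<omega>)"
  let ?F = "reciprocal_cauchy \<mu>"
  have [measurable]: "R \<in> borel_measurable M" using R by simp
  define \<phi> where "\<phi> \<zeta> = complex_of_real (1 / c) * (LINT t|?\<rho>. complex_of_real t * \<zeta> / (\<zeta> - complex_of_real t))" for \<zeta>
  have \<phi>: "\<phi> \<zeta> = (LINT \<omega>|M. complex_of_real (R \<omega>) * \<zeta> / (\<zeta> - complex_of_real (c * R \<omega>)))" for \<zeta>
  proof -
    have "(LINT t|?\<rho>. complex_of_real t * \<zeta> / (\<zeta> - complex_of_real t)) =
        (LINT \<omega>|M. complex_of_real (c * R \<omega>) * \<zeta> / (\<zeta> - complex_of_real (c * R \<omega>)))"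
      by (rule integral_distr) auto
    also have "\<dots> = (LINT \<omega>|M. complex_of_real c * (complex_of_real (R \<omega>) * \<zeta> / (\<zeta> - complex_of_real (c * R \<omega>))))"
      by (simp add: mult.assoc)
    also have "\<dots> = complex_of_real c * (LINT \<omega>|M. complex_of_real (R \<omega>) * \<zeta> / (\<zeta> - complex_of_real (c * R \<omega>)))"
      by (rule integral_mult_right_zero)
    finally show ?thesis using c by (simp add: \<phi>_def)
  qed
  have \<phi>_hol: "\<phi> holomorphic_on {\<zeta>. 0 < Im \<zeta>}"
  proof -
    have "\<phi> \<zeta> = - \<zeta> * (LINT \<omega>|M. complex_of_real (R \<omega>) / (complex_of_real (c * R \<omega>) - \<zeta>))" for \<zeta>
    proof -
      have "complex_of_real (R \<omega>) * \<zeta> / (\<zeta> - complex_of_real (c * R \<omega>)) =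
          - \<zeta> * (complex_of_real (R \<omega>) / (complex_of_real (c * R \<omega>) - \<zeta>))" for \<omega>
        by (metis (no_types, opaque_lifting) minus_diff_eq minus_divide_divide minus_mult_left mult.commute times_divide_eq_right)
      then show ?thesis unfolding \<phi> by (simp only: integral_mult_right_zero)
    qed
    then have \<phi>': "\<phi> = (\<lambda>\<zeta>. - \<zeta> * (LINT \<omega>|M. complex_of_real (R \<omega>) / (complex_of_real (c * R \<omega>) - \<zeta>)))"
      by (rule ext)
    show ?thesis
      unfolding \<phi>' by (intro holomorphic_intros stieltjes_integral_holomorphic R) measurable
  qed
  have s0: "stieltjes \<mu> z \<noteq> 0" if "Im z > 0" for z
    using stieltjes_nonzero_of_equation[OF that eq[OF that]] .
  have inj: "inj_on (stieltjes \<mu>) {z. Im z > 0}"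
  proof (rule inj_onI)
    fix x y assume "x \<in> {z. Im z > 0}" "y \<in> {z. Im z > 0}" "stieltjes \<mu> x = stieltjes \<mu> y"
    then show "x = y" using eq[of x] eq[of y] by (metis add_left_cancel mem_Collect_eq)
  qed
  have F: "?F z = - 1 / stieltjes \<mu> z" for z by (simp add: reciprocal_cauchy_def cauchy_transform_def)
  have left: "?F z + \<phi> (?F z) = z" if z: "Im z > 0" for z
  proof -
    have "complex_of_real (R \<omega>) * ?F z / (?F z - complex_of_real (c * R \<omega>)) =
        complex_of_real (R \<omega>) / (1 + complex_of_real (c * R \<omega>) * stieltjes \<mu> z)" for \<omega>
    proof -
      have "?F z - complex_of_real (c * R \<omega>) = ?F z * (1 + complex_of_real (c * R \<omega>) * stieltjes \<mu> z)"
        using s0[OF z] by (simp add: F field_simps)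
      moreover have "?F z \<noteq> 0" using s0[OF z] by (simp add: F)
      ultimately show ?thesis by simp
    qed
    then have "\<phi> (?F z) = 1 / stieltjes \<mu> z + z" unfolding \<phi> by (simp only: eq[OF z])
    then show ?thesis by (simp add: F)
  qed
  have "has_Voiculescu_transform \<mu> \<phi>"
    unfolding has_Voiculescu_transform_def
  proof (intro allI impI)
    fix \<alpha> :: real assume \<alpha>: "\<alpha> > 0"
    \<comment> \<open>On the cone \<open>cmod \<zeta> \<le> (1 + \<alpha>) * Im \<zeta>\<close>, so \<open>K\<close> bounds \<open>\<phi>\<close>, and \<open>Im (h \<zeta>) > 0\<close> above height \<open>K\<close>. The added \<open>1\<close> keeps \<open>\<beta>\<close> positive when \<open>R\<close> has mean zero.\<close>
    define K where "K = (1 + \<alpha>) * (LINT \<omega>|M. R \<omega>)"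
    define \<beta> where "\<beta> = K + 1"
    have K: "0 \<le> K" using \<alpha> R by (simp add: K_def)
    have \<beta>: "\<beta> > 0" using K by (simp add: \<beta>_def)
    let ?D = "truncated_cone \<alpha> \<beta>"
    have DH: "0 < Im \<zeta>" if "\<zeta> \<in> ?D" for \<zeta> using that \<beta> by (simp add: truncated_cone_def)
    have bound: "cmod (\<phi> \<zeta>) \<le> K" if \<zeta>: "\<zeta> \<in> ?D" for \<zeta>
    proof -
      note p = DH[OF \<zeta>]
      have "cmod \<zeta> \<le> \<bar>Re \<zeta>\<bar> + \<bar>Im \<zeta>\<bar>" by (rule cmod_le)
      also have "\<dots> \<le> (1 + \<alpha>) * Im \<zeta>" using \<zeta> p by (simp add: truncated_cone_def algebra_simps)
      finally have cz: "cmod \<zeta> \<le> (1 + \<alpha>) * Im \<zeta>" .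
      have pt: "cmod (complex_of_real (R \<omega>) * \<zeta> / (\<zeta> - complex_of_real (c * R \<omega>))) \<le> (1 + \<alpha>) * R \<omega>" for \<omega>
      proof -
        have low: "Im \<zeta> \<le> cmod (\<zeta> - complex_of_real (c * R \<omega>))"
          using abs_Im_le_cmod[of "\<zeta> - complex_of_real (c * R \<omega>)"] p by simp
        have "cmod \<zeta> / cmod (\<zeta> - complex_of_real (c * R \<omega>)) \<le> ((1 + \<alpha>) * Im \<zeta>) / Im \<zeta>"
          using cz low p \<alpha> by (intro frac_le) auto
        then have "cmod \<zeta> / cmod (\<zeta> - complex_of_real (c * R \<omega>)) \<le> 1 + \<alpha>" using p by simp
        then have "R \<omega> * (cmod \<zeta> / cmod (\<zeta> - complex_of_real (c * R \<omega>))) \<le> R \<omega> * (1 + \<alpha>)"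
          using R(2) by (intro mult_left_mono) auto
        then show ?thesis using R(2)[of \<omega>] by (simp add: norm_mult norm_divide mult_ac)
      qed
      have i: "integrable M (\<lambda>\<omega>. (1 + \<alpha>) * R \<omega>)" using R by simp
      have "integrable M (\<lambda>\<omega>. complex_of_real (R \<omega>) * \<zeta> / (\<zeta> - complex_of_real (c * R \<omega>)))"
      proof (rule Bochner_Integration.integrable_bound[OF i])
        show "AE \<omega> in M. cmod (complex_of_real (R \<omega>) * \<zeta> / (\<zeta> - complex_of_real (c * R \<omega>))) \<le> norm ((1 + \<alpha>) * R \<omega>)"
          unfolding real_norm_def by (intro AE_I2 order_trans[OF pt abs_ge_self])
      qed measurable
      then have "cmod (\<phi> \<zeta>) \<le> (LINT \<omega>|M. (1 + \<alpha>) * R \<omega>)"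
        unfolding \<phi> by (intro order_trans[OF integral_norm_bound] integral_mono integrable_norm i pt)
      then show ?thesis by (simp add: K_def)
    qed
    define h where "h \<zeta> = \<zeta> + \<phi> \<zeta>" for \<zeta>
    have Imh: "Im (h \<zeta>) > 0" if \<zeta>: "\<zeta> \<in> ?D" for \<zeta>
      using bound[OF \<zeta>] abs_Im_le_cmod[of "\<phi> \<zeta>"] abs_ge_minus_self[of "Im (\<phi> \<zeta>)"] \<zeta>
      by (simp add: h_def truncated_cone_def \<beta>_def)
    have hol: "h holomorphic_on ?D"
      unfolding h_def using DH by (intro holomorphic_intros holomorphic_on_subset[OF \<phi>_hol]) auto
    have inv: "?F (h \<zeta>) = \<zeta>" if "\<zeta> \<in> ?D" for \<zeta>
      by (rule right_inverse_of_left_inverse[OF \<mu> \<alpha> s0 inj _ hol Imh that]) (simp_all add: h_def left)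
    have "((\<lambda>\<zeta>. h \<zeta> / \<zeta> - 1) \<longlongrightarrow> 0) (inf at_infinity (principal ?D))"
    proof (rule Lim_null_comparison)
      show "eventually (\<lambda>\<zeta>. cmod (h \<zeta> / \<zeta> - 1) \<le> K * inverse (cmod \<zeta>)) (inf at_infinity (principal ?D))"
        unfolding eventually_inf_principal
      proof (intro always_eventually allI impI)
        fix \<zeta> assume \<zeta>: "\<zeta> \<in> ?D"
        then have "\<zeta> \<noteq> 0" using DH by force
        then have "h \<zeta> / \<zeta> - 1 = \<phi> \<zeta> / \<zeta>" by (simp add: h_def field_simps)
        then show "cmod (h \<zeta> / \<zeta> - 1) \<le> K * inverse (cmod \<zeta>)"
          using mult_right_mono[OF bound[OF \<zeta>], of "inverse (cmod \<zeta>)"]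
          by (simp only: norm_divide divide_inverse norm_mult norm_inverse) simp
      qed
      have "((\<lambda>\<zeta>::complex. K * inverse (cmod \<zeta>)) \<longlongrightarrow> K * 0) at_infinity"
        by (intro tendsto_intros tendsto_inverse_0_at_top filterlim_at_infinity_imp_norm_at_top filterlim_ident)
      then show "((\<lambda>\<zeta>::complex. K * inverse (cmod \<zeta>)) \<longlongrightarrow> 0) (inf at_infinity (principal ?D))"
        by (auto intro: tendsto_mono[OF inf_le1])
    qed
    then have "F_right_inverse_on \<mu> ?D h"
      using hol Imh inv by (simp add: F_right_inverse_on_def LIM_zero_iff)
    then show "\<exists>\<beta>>0. \<exists>h. F_right_inverse_on \<mu> (truncated_cone \<alpha> \<beta>) h \<and> (\<forall>\<zeta>\<in>truncated_cone \<alpha> \<beta>. \<phi> \<zeta> = h \<zeta> - \<zeta>)"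
      using \<beta> by (intro exI[of _ \<beta>] conjI exI[of _ h] ballI) (simp_all add: h_def)
  qed
  moreover have "real_distribution ?\<rho>"
    by (intro real_distribution.intro M.prob_space_distr real_distribution_axioms.intro) auto
  moreover have "AE t in ?\<rho>. 0 \<le> t" using R(2) c by (subst AE_distr_iff) auto
  ultimately show ?thesis
    using c \<mu> by (simp add: is_free_compound_Poisson_def \<phi>_def[abs_def])
qed

section \<open>Lognormal jumps\<close>

text \<open>
Completing the square turns the weighted Gaussian density into a shifted one.
\<close>

lemma lognormal_moments:
  fixes Z :: "'a \<Rightarrow> real"
  assumes Z: "distributed M lborel Z std_normal_density" and v: "v \<ge> 0"
  defines "R \<equiv> (\<lambda>\<omega>. exp (sqrt v * Z \<omega> - v / 2))"
  shows "integrable M (\<lambda>\<omega>. R \<omega> ^ k)"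
    "(LINT \<omega>|M. R \<omega> ^ k) = exp (real k * (real k - 1) / 2 * v)"
proof -
  let ?g = "\<lambda>x. exp (sqrt v * x - v / 2) ^ k"
  let ?e = "exp (real k * (real k - 1) / 2 * v)"
  have s: "sqrt v * sqrt v = v" using v by simp
  have eq: "std_normal_density x * ?g x = ?e * normal_density (real k * sqrt v) 1 x" for x
  proof -
    have "- x\<^sup>2 / 2 + real k * (sqrt v * x - v / 2) =
        real k * (real k - 1) / 2 * v + - (x - real k * sqrt v)\<^sup>2 / 2"
      using s by (simp add: power2_eq_square field_simps)
    then have "exp (- x\<^sup>2 / 2) * ?g x = ?e * exp (- (x - real k * sqrt v)\<^sup>2 / 2)"
      by (simp add: exp_of_nat_mult[symmetric] flip: exp_add)
    then show ?thesis by (simp add: normal_density_def)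
  qed
  have i: "integrable lborel (\<lambda>x. std_normal_density x * ?g x)"
    unfolding eq by (intro integrable_mult_right integrable_normal_density) simp
  have I: "(LINT x|lborel. std_normal_density x * ?g x) = ?e"
    unfolding eq by (simp add: integral_normal_density)
  show "integrable M (\<lambda>\<omega>. R \<omega> ^ k)"
    using i distributed_integrable[OF Z, of ?g] by (simp add: R_def)
  show "(LINT \<omega>|M. R \<omega> ^ k) = ?e"
    using I distributed_integral[OF Z, of ?g] by (simp add: R_def)
qed

theorem proposition8p1:
  fixes c lam v :: real
    and M :: "'a measure" and Z R :: "'a \<Rightarrow> real"
    and \<mu> :: "real measure"
  assumes "c > 0" and "lam \<ge> 0" and "v \<ge> 0"
    and "prob_space M"
    and "distributed M lborel Z std_normal_density"
    and "R = (\<lambda>\<omega>. exp (sqrt (lam * v) * Z \<omega> - lam * v / 2))"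
    and "real_distribution \<mu>" and "AE t in \<mu>. 0 \<le> t"
    and "\<forall>z. Im z > 0 \<longrightarrow>
           1 / stieltjes \<mu> z + z =
           (LINT \<omega>|M. complex_of_real (R \<omega>) /
              (1 + complex_of_real (c * R \<omega>) * stieltjes \<mu> z))"
  shows "is_free_compound_Poisson (1 / c) (distr M borel (\<lambda>\<omega>. c * R \<omega>)) \<mu> \<and>
    (\<forall>k\<ge>1. integrable \<mu> (\<lambda>t. t ^ k) \<and>
       moment \<mu> k =
         (\<Sum>P\<in>NC k. c ^ (k - card P) * (\<Prod>V\<in>P. LINT \<omega>|M. R \<omega> ^ card V))) \<and>
    (\<forall>k\<ge>1. free_cumulant \<mu> k = c ^ (k - 1) * (LINT \<omega>|M. R \<omega> ^ k) \<and>
       c ^ (k - 1) * (LINT \<omega>|M. R \<omega> ^ k) =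
         c ^ (k - 1) * exp (real k * (real k - 1) / 2 * (lam * v)))"
proof -
  have lv: "lam * v \<ge> 0" using assms(2,3) by simp
  have R: "integrable M (\<lambda>\<omega>. R \<omega> ^ k)" "(LINT \<omega>|M. R \<omega> ^ k) = exp (real k * (real k - 1) / 2 * (lam * v))" for k
    unfolding assms(6) using lognormal_moments[OF assms(5) lv, of k] by auto
  have Rpos: "0 \<le> R \<omega>" for \<omega> by (simp add: assms(6))
  have R1: "integrable M R" using R(1)[of 1] by simp
  note eq = assms(9)[rule_format]
  note m = moments_of_equation[OF assms(7,8) R(1) Rpos assms(1) eq]
  show ?thesis
  proof (intro conjI allI impI)
    show "is_free_compound_Poisson (1 / c) (distr M borel (\<lambda>\<omega>. c * R \<omega>)) \<mu>"
      by (rule free_compound_Poisson_of_equation[OF assms(7,4) R1 Rpos assms(1) eq])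
    fix k :: nat assume k: "k \<ge> 1"
    show "integrable \<mu> (\<lambda>t. t ^ k)" by (rule m(1))
    show "moment \<mu> k = (\<Sum>P\<in>NC k. c ^ (k - card P) * (\<Prod>V\<in>P. LINT \<omega>|M. R \<omega> ^ card V))"
      using m(2)[of k] NC_prod_power[of _ k c "\<lambda>j. LINT \<omega>|M. R \<omega> ^ j"] by simp
    show "free_cumulant \<mu> k = c ^ (k - 1) * (LINT \<omega>|M. R \<omega> ^ k)"
      by (rule free_cumulantI[where \<kappa> = "\<lambda>j. c ^ (j - 1) * (LINT \<omega>|M. R \<omega> ^ j)", OF m(2) k])
    show "c ^ (k - 1) * (LINT \<omega>|M. R \<omega> ^ k) = c ^ (k - 1) * exp (real k * (real k - 1) / 2 * (lam * v))"
      by (simp only: R(2))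
  qed
qed

end
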